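(* Let $X$ be an $\Omega$-$1$-polygraph and $\Sigma(X)$ the linear $1$-polygraph associated with it. There exists a one-to-one correspondence between the sets of critical branchings $\mathrm{CB}(X)$ and $\mathrm{CB}(\Sigma(X))$.
   Context: $\mathbf k$ is a field of characteristic zero, $\Omega$ is a set. For a set $Z$, the free $\Omega$-monoid $Z^\Omega$ is the union of $Z^\Omega_0=Z^*\subset Z^\Omega_1\subset\cdots$, $Z_n^\Omega=(Z\sqcup\{\lfloor u\rfloor_\tau: u\in Z^\Omega_{n-1},\tau\in\Omega\})^*$, with operators $u\mapsto\lfloor u\rfloor_\tau$; set $\lfloor u\rfloor_0=u$, $0\notin\Omega$. $\mathscr A_\Omega(Z)$ is the $\mathbf k$-linear span of $Z^\Omega$ (free $\Omega$-algebra); $\mathrm{supp}(a)$ is the set of monomials with nonzero coefficient in $a$. $Z^\Omega[\square]$ is the set of elements of $(Z\sqcup\{\square\})^\Omega$ in which $\square$ occurs exactly once; $q|_a$ denotes substitution of $a$ for $\square$. An $\Omega$-$1$-polygraph $X=(Z,X_1)$ is a set $Z$ and a set $X_1$ of generators $\alpha:s(\alpha)\to t(\alpha)$ with $s(\alpha),t(\alpha)\in\mathscr A_\Omega(Z)$; all are assumed left-monomial: $s(\alpha)\in Z^\Omega$, $s(\alpha)\notin\mathrm{supp}(t(\alpha))$. A linear $1$-polygraph is the case $\Omega=\emptyset$. The free $1$-algebra $\mathscr A_\Omega(X)$ is obtained from $\mathscr A_\Omega(Z)$ by freely adjoining the $\alpha$ as $1$-cells (in internal categories in $\Omega$-algebras).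 A $1$-monomial is $q|_\alpha:q|_{s(\alpha)}\to q|_{t(\alpha)}$, $\alpha\in X_1$, $q\in Z^\Omega[\square]$. Local branchings are pairs of rewriting steps ($1$-cells $\lambda f+1_c$ with $\lambda\neq0$, $f$ a $1$-monomial, $s(f)\notin\mathrm{supp}(c)$) with the same source, of four types: aspherical $(\lambda f+c,\lambda f+c)$; additive $(\lambda f+\mu v+c,\lambda u+\mu g+c)$ for $1$-monomials $f:u\to a$, $g:v\to b$, $u\ne v$, $\lambda,\mu\ne0$, $u,v\notin\mathrm{supp}(c)$; Peiffer $(\lambda q|_{\lfloor fv\rfloor_\tau}+c,\lambda q|_{\lfloor ug\rfloor_\tau}+c)$ for $1$-monomials $f:u\to a$, $g:v\to b$, $\tau\in\Omega\sqcup\{0\}$, $\lambda\neq 0$, $q|_{\lfloor uv\rfloor_\tau}\notin\mathrm{supp}(c)$; overlapping $(\lambda f+c,\lambda g+c)$ for $1$-monomials $f:u\to a$, $g:u\to b$ with $(f,g)$ none of the previous types, $\lambda\ne0$, $u\notin\mathrm{supp}(c)$. A critical branching is an overlapping branching with $\lambda=1$, $c=0$ that cannot be written $(q|_{f'},q|_{g'})$ with $q\in Z^\Omega[\square]$, $q\ne\square$. $\mathrm{CB}(X)$ is the set of critical branchings of $X$; for a linear $1$-polygraph it is defined by the same definition with $\Omega=\emptyset$. The linear $1$-polygraph $\Sigma(X)=(\Sigma_0,\Sigma_1)$ has $\Sigma_0=Z\sqcup\{\mathsf\ell_\tau,\mathsf r_\tau:\tau\in\Omega\}$ and $\Sigma_1=\{\psi^{-1}(a)\to\psi^{-1}(b)\mid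 (a\to b)\in X_1\}$, where $\psi^{-1}$ is the linear map from $\mathscr A_\Omega(Z)$ to the free associative algebra on $\Sigma_0$ which sends each monomial of $Z^\Omega$ to the word of $\Sigma_0^*$ obtained by replacing each left bracket of an operator $\lfloor\ \rfloor_\tau$ by $\mathsf\ell_\tau$ and the matching right bracket by $\mathsf r_\tau$. *)

theory Defs
  imports "HOL-Library.Poly_Mapping"
begin

(* Lists form a monoid under concatenation.  It is written additively because the key type of
   poly_mapping must be an additive monoid for the convolution product, which turns finitely
   supported functions on lists into the monoid algebra. *)

instantiation list :: (type) monoid_add
begin

definition zero_list :: "'a list" where "zero_list = []"
definition plus_list :: "'a list \<Rightarrow> 'a list \<Rightarrow> 'a list" where "plus_list xs ys = xs @ ys"

instance by standard (simp_all add: zero_list_def plus_list_def)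

end

section \<open>Free operated monoids and free operated algebras\<close>

datatype ('z, 'o) letter = Var 'z | Br 'o "('z, 'o) letter list"

type_synonym ('z, 'o) mon = "('z, 'o) letter list"

primrec free_mon_stage :: "'o set \<Rightarrow> 'z set \<Rightarrow> nat \<Rightarrow> ('z, 'o) mon set" where
  "free_mon_stage \<Omega> Z 0 = lists (Var ` Z)"
| "free_mon_stage \<Omega> Z (Suc n) =
     lists (Var ` Z \<union> {Br \<tau> u | \<tau> u. \<tau> \<in> \<Omega> \<and> u \<in> free_mon_stage \<Omega> Z n})"

definition free_mon :: "'o set \<Rightarrow> 'z set \<Rightarrow> ('z, 'o) mon set" where
  "free_mon \<Omega> Z = (\<Union>n. free_mon_stage \<Omega> Z n)"

(* The index None stands for the symbol 0 that is not in Omega. *)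
fun bracket :: "'o option \<Rightarrow> ('z, 'o) mon \<Rightarrow> ('z, 'o) mon" where
  "bracket None u = u"
| "bracket (Some \<tau>) u = [Br \<tau> u]"

type_synonym ('z, 'o, 'k) alg = "('z, 'o) mon \<Rightarrow>\<^sub>0 'k"

definition free_alg :: "'o set \<Rightarrow> 'z set \<Rightarrow> ('z, 'o, 'k::zero) alg set" where
  "free_alg \<Omega> Z = {a. Poly_Mapping.keys a \<subseteq> free_mon \<Omega> Z}"

definition monomial :: "('z, 'o) mon \<Rightarrow> ('z, 'o, 'k::zero_neq_one) alg" where
  "monomial u = Poly_Mapping.single u 1"

definition scale :: "'k::semiring_0 \<Rightarrow> ('z, 'o, 'k) alg \<Rightarrow> ('z, 'o, 'k) alg" where
  "scale c a = Poly_Mapping.map ((*) c) a"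

definition lin_ext ::
    "(('z, 'o) mon \<Rightarrow> ('y, 'p, 'k) alg) \<Rightarrow> ('z, 'o, 'k::semiring_0) alg \<Rightarrow> ('y, 'p, 'k) alg" where
  "lin_ext h a = (\<Sum>u\<in>Poly_Mapping.keys a. scale (Poly_Mapping.lookup a u) (h u))"

definition oper :: "'o option \<Rightarrow> ('z, 'o, 'k::semiring_1) alg \<Rightarrow> ('z, 'o, 'k) alg" where
  "oper \<tau> = lin_ext (\<lambda>u. monomial (bracket \<tau> u))"

primrec eval_letter ::
    "('z \<Rightarrow> ('y, 'o, 'k) alg) \<Rightarrow> ('z, 'o) letter \<Rightarrow> ('y, 'o, 'k::semiring_1) alg" where
  "eval_letter \<sigma> (Var z) = \<sigma> z"
| "eval_letter \<sigma> (Br \<tau> w) = oper (Some \<tau>) (prod_list (map (eval_letter \<sigma>) w))"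

definition eval_mon ::
    "('z \<Rightarrow> ('y, 'o, 'k) alg) \<Rightarrow> ('z, 'o) mon \<Rightarrow> ('y, 'o, 'k::semiring_1) alg" where
  "eval_mon \<sigma> w = prod_list (map (eval_letter \<sigma>) w)"

(* The morphism of operated algebras extending an assignment of the variables. *)
definition hom_ext ::
    "('z \<Rightarrow> ('y, 'o, 'k) alg) \<Rightarrow> ('z, 'o, 'k::semiring_1) alg \<Rightarrow> ('y, 'o, 'k) alg" where
  "hom_ext \<sigma> = lin_ext (eval_mon \<sigma>)"

section \<open>One-hole contexts\<close>

(* In a context, Var None is the hole. *)
primrec holes :: "('z option, 'o) letter \<Rightarrow> nat" where
  "holes (Var x) = (case x of None \<Rightarrow> 1 | Some z \<Rightarrow> 0)"
| "holes (Br \<tau> w) = sum_list (map holes w)"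

definition contexts :: "'o set \<Rightarrow> 'z set \<Rightarrow> ('z option, 'o) mon set" where
  "contexts \<Omega> Z =
     {q \<in> free_mon \<Omega> (insert None (Some ` Z)). sum_list (map holes q) = 1}"

definition hole :: "('z option, 'o) mon" where
  "hole = [Var None]"

section \<open>Polygraphs and the free 1-algebra\<close>

record (overloaded) ('z, 'o, 'g, 'k) polygraph =
  ops :: "'o set"
  vars :: "'z set"
  gens :: "'g set"
  src :: "'g \<Rightarrow> ('z, 'o, 'k) alg"
  tgt :: "'g \<Rightarrow> ('z, 'o, 'k) alg"

definition left_monomial_polygraph :: "('z, 'o, 'g, 'k::field_char_0) polygraph \<Rightarrow> bool" where
  "left_monomial_polygraph X \<longleftrightarrow>
     (\<forall>\<alpha>\<in>gens X. tgt X \<alpha> \<in> free_alg (ops X) (vars X) \<and>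
        (\<exists>u\<in>free_mon (ops X) (vars X).
           src X \<alpha> = monomial u \<and> u \<notin> Poly_Mapping.keys (tgt X \<alpha>)))"

definition cells0 :: "('z, 'o, 'g, 'k::field_char_0) polygraph \<Rightarrow> ('z, 'o, 'k) alg set" where
  "cells0 X = free_alg (ops X) (vars X)"

(* The free reflexive graph in operated algebras on X has 0-cells A(Z) and 1-cells A(Z + X_1).
   The 1-cells of the free internal category are obtained from it as a quotient, see below. *)
definition pre_cells1 ::
    "('z, 'o, 'g, 'k::field_char_0) polygraph \<Rightarrow> ('z + 'g, 'o, 'k) alg set" where
  "pre_cells1 X = free_alg (ops X) (vars X <+> gens X)"

definition idc :: "('z, 'o, 'k::field_char_0) alg \<Rightarrow> ('z + 'g, 'o, 'k) alg" where
  "idc = hom_ext (\<lambda>z. monomial [Var (Inl z)])"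

definition source ::
    "('z, 'o, 'g, 'k::field_char_0) polygraph \<Rightarrow> ('z + 'g, 'o, 'k) alg \<Rightarrow> ('z, 'o, 'k) alg" where
  "source X = hom_ext (case_sum (\<lambda>z. monomial [Var z]) (src X))"

definition target ::
    "('z, 'o, 'g, 'k::field_char_0) polygraph \<Rightarrow> ('z + 'g, 'o, 'k) alg \<Rightarrow> ('z, 'o, 'k) alg" where
  "target X = hom_ext (case_sum (\<lambda>z. monomial [Var z]) (tgt X))"

(* In an internal category in vector spaces, linearity and the unit laws force the composite of
   f : a -> b and g : b -> c to be f - 1_b + g. *)
definition comp1 ::
    "('z, 'o, 'g, 'k::field_char_0) polygraph \<Rightarrow> ('z + 'g, 'o, 'k) alg \<Rightarrow> ('z + 'g, 'o, 'k) alg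
      \<Rightarrow> ('z + 'g, 'o, 'k) alg" where
  "comp1 X f g = f - idc (target X f) + g"

(* With this composition all axioms of an internal category in operated algebras hold in the free
   reflexive graph, except that the product need not be compatible with composition.  The
   1-cells of the free 1-algebra are therefore the quotient by the operated ideal below. *)
inductive_set exchange_ideal ::
    "('z, 'o, 'g, 'k::field_char_0) polygraph \<Rightarrow> ('z + 'g, 'o, 'k) alg set"
  for X :: "('z, 'o, 'g, 'k) polygraph" where
  exchange: "\<lbrakk>f \<in> pre_cells1 X; f' \<in> pre_cells1 X; g \<in> pre_cells1 X; g' \<in> pre_cells1 X;
      target X f = source X f'; target X g = source X g'\<rbrakk>
    \<Longrightarrow> comp1 X f f' * comp1 X g g' - comp1 X (f * g) (f' * g') \<in> exchange_ideal X"
| add: "\<lbrakk>x \<in> exchange_ideal X; y \<in> exchange_ideal X\<rbrakk> \<Longrightarrow> x + y \<in> exchange_ideal X"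
| mult_left: "\<lbrakk>a \<in> pre_cells1 X; x \<in> exchange_ideal X\<rbrakk> \<Longrightarrow> a * x \<in> exchange_ideal X"
| mult_right: "\<lbrakk>a \<in> pre_cells1 X; x \<in> exchange_ideal X\<rbrakk> \<Longrightarrow> x * a \<in> exchange_ideal X"
| oper: "\<lbrakk>\<tau> \<in> ops X; x \<in> exchange_ideal X\<rbrakk> \<Longrightarrow> oper (Some \<tau>) x \<in> exchange_ideal X"

type_synonym ('z, 'o, 'g, 'k) cell1 = "('z + 'g, 'o, 'k) alg set"

definition cell ::
    "('z, 'o, 'g, 'k::field_char_0) polygraph \<Rightarrow> ('z + 'g, 'o, 'k) alg \<Rightarrow> ('z, 'o, 'g, 'k) cell1"
  where
  "cell X f = {f' \<in> pre_cells1 X. f' - f \<in> exchange_ideal X}"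

definition plug :: "('z option, 'o) mon \<Rightarrow> ('z + 'g, 'o, 'k::field_char_0) alg
      \<Rightarrow> ('z + 'g, 'o, 'k) alg" where
  "plug q f = eval_mon (case_option f (\<lambda>z. monomial [Var (Inl z)])) q"

(* Representatives of the 1-monomials; the 1-monomials themselves are their classes under cell. *)
definition monomials1 ::
    "('z, 'o, 'g, 'k::field_char_0) polygraph \<Rightarrow> ('z + 'g, 'o, 'k) alg set" where
  "monomials1 X =
     {plug q (monomial [Var (Inr \<alpha>)]) | q \<alpha>. q \<in> contexts (ops X) (vars X) \<and> \<alpha> \<in> gens X}"

section \<open>Local and critical branchings\<close>

definition aspherical ::
    "('z, 'o, 'g, 'k::field_char_0) polygraph \<Rightarrow>
      (('z, 'o, 'g, 'k) cell1 \<times> ('z, 'o, 'g, 'k) cell1) set" where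
  "aspherical X =
     {(cell X (scale \<kappa> f + idc c), cell X (scale \<kappa> f + idc c)) | \<kappa> f u c.
        \<kappa> \<noteq> 0 \<and> f \<in> monomials1 X \<and> c \<in> cells0 X \<and>
        source X f = monomial u \<and> u \<notin> Poly_Mapping.keys c}"

definition additive ::
    "('z, 'o, 'g, 'k::field_char_0) polygraph \<Rightarrow>
      (('z, 'o, 'g, 'k) cell1 \<times> ('z, 'o, 'g, 'k) cell1) set" where
  "additive X =
     {(cell X (scale \<kappa> f + scale \<mu> (idc (monomial v)) + idc c),
       cell X (scale \<kappa> (idc (monomial u)) + scale \<mu> g + idc c)) | \<kappa> \<mu> f g u v c.
        \<kappa> \<noteq> 0 \<and> \<mu> \<noteq> 0 \<and> f \<in> monomials1 X \<and> g \<in> monomials1 X \<and> c \<in> cells0 X \<and>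
        source X f = monomial u \<and> source X g = monomial v \<and> u \<noteq> v \<and>
        u \<notin> Poly_Mapping.keys c \<and> v \<notin> Poly_Mapping.keys c}"

definition peiffer ::
    "('z, 'o, 'g, 'k::field_char_0) polygraph \<Rightarrow>
      (('z, 'o, 'g, 'k) cell1 \<times> ('z, 'o, 'g, 'k) cell1) set" where
  "peiffer X =
     {(cell X (scale \<kappa> (plug q (oper \<tau> (f * idc (monomial v)))) + idc c),
       cell X (scale \<kappa> (plug q (oper \<tau> (idc (monomial u) * g))) + idc c)) | \<kappa> q \<tau> f g u v w c.
        \<kappa> \<noteq> 0 \<and> q \<in> contexts (ops X) (vars X) \<and> \<tau> \<in> insert None (Some ` ops X) \<and>
        f \<in> monomials1 X \<and> g \<in> monomials1 X \<and> c \<in> cells0 X \<and>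
        source X f = monomial u \<and> source X g = monomial v \<and>
        source X (plug q (oper \<tau> (idc (monomial (u @ v))))) = monomial w \<and>
        w \<notin> Poly_Mapping.keys c}"

(* A branching is an ordered pair, but its type does not depend on the order of its two cells.
   The aspherical and additive types are symmetric as they stand; the Peiffer type is not, since
   the factor rewritten by the first cell stands on the left, hence the converse. *)
definition overlapping ::
    "('z, 'o, 'g, 'k::field_char_0) polygraph \<Rightarrow> 'k \<Rightarrow> ('z, 'o, 'k) alg \<Rightarrow>
      (('z, 'o, 'g, 'k) cell1 \<times> ('z, 'o, 'g, 'k) cell1) set" where
  "overlapping X \<kappa> c =
     {(cell X (scale \<kappa> f + idc c), cell X (scale \<kappa> g + idc c)) | f g u.
        \<kappa> \<noteq> 0 \<and> f \<in> monomials1 X \<and> g \<in> monomials1 X \<and> c \<in> cells0 X \<and>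
        source X f = monomial u \<and> source X g = monomial u \<and> u \<notin> Poly_Mapping.keys c \<and>
        (cell X f, cell X g) \<notin> aspherical X \<union> additive X \<union> peiffer X \<union> (peiffer X)\<inverse>}"

definition critical_branchings ::
    "('z, 'o, 'g, 'k::field_char_0) polygraph \<Rightarrow>
      (('z, 'o, 'g, 'k) cell1 \<times> ('z, 'o, 'g, 'k) cell1) set" where
  "critical_branchings X =
     {(F, G) \<in> overlapping X 1 0.
        \<not> (\<exists>q f' g'. q \<in> contexts (ops X) (vars X) \<and> q \<noteq> hole \<and>
              f' \<in> monomials1 X \<and> g' \<in> monomials1 X \<and>
              F = cell X (plug q f') \<and> G = cell X (plug q g'))}"

section \<open>The associated linear polygraph\<close>

datatype ('z, 'o) bletter = Letter 'z | LeftBr 'o | RightBr 'o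

primrec flatten_letter :: "('z, 'o) letter \<Rightarrow> (('z, 'o) bletter, 'o) mon" where
  "flatten_letter (Var z) = [Var (Letter z)]"
| "flatten_letter (Br \<tau> w) =
     Var (LeftBr \<tau>) # concat (map flatten_letter w) @ [Var (RightBr \<tau>)]"

definition psi_inv :: "('z, 'o, 'k::field_char_0) alg \<Rightarrow> (('z, 'o) bletter, 'o, 'k) alg" where
  "psi_inv = lin_ext (\<lambda>w. monomial (concat (map flatten_letter w)))"

(* A linear 1-polygraph is a polygraph with no operators, so that its monomials are the words in
   its variables and the type of operators plays no role. *)
definition linear_polygraph_of ::
    "('z, 'o, 'g, 'k::field_char_0) polygraph \<Rightarrow> (('z, 'o) bletter, 'o, 'g, 'k) polygraph" where
  "linear_polygraph_of X =
     \<lparr>ops = {},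
      vars = Letter ` vars X \<union> LeftBr ` ops X \<union> RightBr ` ops X,
      gens = gens X,
      src = (\<lambda>\<alpha>. psi_inv (src X \<alpha>)),
      tgt = (\<lambda>\<alpha>. psi_inv (tgt X \<alpha>))\<rparr>"

end

theory Submission
  imports Defs
begin

text \<open>
  Writing brackets as letters identifies the monomials over the variables and operators with the
  balanced words, those that leave no bracket open when they are read with a stack. The proof
  shows that this identification induces a bijection between pairs of one-monomials that represent
  critical branchings, compatible with equality of one-cells.

  A one-monomial is a monomial with a single generator among its letters, and putting a balanced
  word in the place of a letter does not affect balance. Thus sources, contexts and Peiffer pairs
  for the polygraph with operators are those for words, restricted to balanced words. Three points
  need an argument.

  Equality of one-cells is equality modulo the exchange ideal. For words this ideal is spanned by
  the elements \<open>u (\<alpha> - d \<alpha>) v (\<beta> - e \<beta>) w\<close>, where \<open>d\<close> and \<open>e\<close> are source and target in one of the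
  two orders. The monomials of such an element are all balanced or all unbalanced, so the
  projection onto balanced words maps the ideal to the exchange ideal of the polygraph with
  operators. Hence both polygraphs identify the same one-monomials
  (\<open>unbracket_alg_exchange_ideal_iff\<close>).

  A branching of words may lie in a context that is not balanced, such as a single bracket. The
  matching bracket encloses a factor of the common source. If the two cells rewrite on different
  sides of its boundary they form a Peiffer pair, otherwise the enclosed factor gives a common
  context with operators (\<open>common_end\<close>).

  Finally, a critical branching of words has a balanced source. Its source is either the source of
  one generator or the union of two overlapping sources of generators, and balanced words overlap
  in a balanced word (\<open>balanced_overlap\<close>, \<open>critical_mons_balanced\<close>).
\<close>

section \<open>Linear extensions\<close>

lemma scale_conv_mult: "scale c a = Poly_Mapping.single 0 c * a"
  by (simp add: scale_def mult_map_scale_conv_mult)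

lemma scale_scale: "scale c (scale d a) = scale (c * d) a"
  by (simp add: scale_conv_mult mult_single flip: mult.assoc)

lemma scale_one [simp]: "scale 1 a = (a :: ('z, 'o, 'k::semiring_1) alg)"
  by (simp add: scale_conv_mult)

lemma scale_monomial: "scale c (monomial u) = Poly_Mapping.single u (c :: 'k::semiring_1)"
  by (simp add: scale_conv_mult monomial_def mult_single)

lemma alg_induct [consumes 1, case_names zero add monomial]:
  fixes a :: "('z, 'o, 'k::semiring_1) alg"
  assumes "Poly_Mapping.keys a \<subseteq> S" and "P 0"
    and "\<And>x y. P x \<Longrightarrow> P y \<Longrightarrow> P (x + y)"
    and mono: "\<And>c u. u \<in> S \<Longrightarrow> P (scale c (monomial u))"
  shows "P a"
proof -
  have "P (\<Sum>u\<in>K. Poly_Mapping.single u (Poly_Mapping.lookup a u))"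
    if "finite K" "K \<subseteq> S" for K
    using that by induction (use assms(2,3) mono in \<open>auto simp: scale_monomial\<close>)
  moreover have "a = (\<Sum>u\<in>Poly_Mapping.keys a. Poly_Mapping.single u (Poly_Mapping.lookup a u))"
    by (rule poly_mapping_eqI)
      (auto simp: lookup_sum lookup_single when_def in_keys_iff sum.delta)
  ultimately show ?thesis
    using assms(1) by (metis finite_keys)
qed

lemma scale_mult_left: "scale c a * b = scale c (a * b)"
  by (simp add: scale_conv_mult mult.assoc)

lemma scale_mult_right:
  fixes a :: "('z, 'o, 'k::comm_semiring_1) alg"
  shows "a * scale c b = scale c (a * b)"
proof -
  have "a * Poly_Mapping.single 0 c = Poly_Mapping.single 0 c * a"
    using subset_UNIV
  proof (induction a rule: alg_induct)
    case (monomial d u)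
    then show ?case by (simp add: scale_monomial mult_single mult.commute)
  qed (simp_all add: distrib_left distrib_right)
  then show ?thesis by (simp add: scale_conv_mult flip: mult.assoc)
qed

lemma lin_ext_zero [simp]: "lin_ext h 0 = 0"
  by (simp add: lin_ext_def)

lemma lin_ext_add: "lin_ext h (a + b) = lin_ext h a + lin_ext h b"
  unfolding lin_ext_def
  by (rule setsum_keys_plus_distrib)
    (simp_all add: scale_conv_mult single_add distrib_right)

lemma lin_ext_single: "lin_ext h (Poly_Mapping.single u c) = scale c (h u)"
  by (cases "c = 0") (simp_all add: lin_ext_def scale_conv_mult)

lemma lin_ext_monomial [simp]:
  "lin_ext h (monomial u) = (h u :: ('z, 'o, 'k::semiring_1) alg)"
  by (simp add: monomial_def lin_ext_single)

lemma lin_ext_scale: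
  fixes a :: "('z, 'o, 'k::semiring_1) alg"
  shows "lin_ext h (scale c a) = scale c (lin_ext h a)"
  using subset_UNIV
proof (induction a rule: alg_induct)
  case (monomial d u)
  show ?case by (simp add: scale_scale scale_monomial[of "c * d"] lin_ext_single)
      (simp add: scale_monomial lin_ext_single scale_scale)
qed (simp_all add: scale_conv_mult lin_ext_add distrib_left)

lemma lin_ext_diff:
  fixes a :: "('z, 'o, 'k::ring_1) alg"
  shows "lin_ext h (a - b) = lin_ext h a - lin_ext h b"
  using lin_ext_add[of h "a - b" b] by (simp add: algebra_simps)

lemma lin_ext_in:
  fixes a :: "('z, 'o, 'k::semiring_1) alg"
  assumes "Poly_Mapping.keys a \<subseteq> S" "\<And>u. u \<in> S \<Longrightarrow> Poly_Mapping.keys (h u) \<subseteq> T"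
  shows "Poly_Mapping.keys (lin_ext h a) \<subseteq> T"
  using assms(1)
proof (induction a rule: alg_induct)
  case (add x y)
  then show ?case using keys_add by (fastforce simp: lin_ext_add)
next
  case (monomial c u)
  then show ?case using assms(2)[of u] keys_mult[of "Poly_Mapping.single 0 c" "h u"]
    by (auto simp: lin_ext_scale scale_conv_mult[of c "h u"] split: if_splits)
qed simp

lemma monomial_mult: "monomial u * monomial v = (monomial (u @ v) :: ('z, 'o, 'k::semiring_1) alg)"
  by (simp add: monomial_def mult_single plus_list_def)

lemma monomial_Nil [simp]: "monomial [] = 1"
  by (metis monomial_def zero_list_def single_one)

lemma lin_ext_mult:
  fixes a b :: "('z, 'o, 'k::comm_semiring_1) alg"
  assumes "\<And>u v. h (u @ v) = h u * h v"
  shows "lin_ext h (a * b) = lin_ext h a * lin_ext h b"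
  using subset_UNIV
proof (induction a rule: alg_induct)
  case (monomial c u)
  show ?case using subset_UNIV
  proof (induction b rule: alg_induct)
    case (monomial d v)
    then show ?case
      by (simp add: scale_mult_left scale_mult_right lin_ext_scale monomial_mult assms)
  qed (simp_all add: lin_ext_add distrib_left)
qed (simp_all add: lin_ext_add distrib_right)

lemma lin_ext_lin_ext:
  fixes a :: "('z, 'o, 'k::semiring_1) alg"
  shows "lin_ext g (lin_ext h a) = lin_ext (\<lambda>u. lin_ext g (h u)) a"
  using subset_UNIV
  by (induction a rule: alg_induct) (simp_all add: lin_ext_add lin_ext_scale)

lemma lin_ext_eqI:
  fixes a :: "('z, 'o, 'k::semiring_1) alg"
  assumes "Poly_Mapping.keys a \<subseteq> S" "\<And>u. u \<in> S \<Longrightarrow> g u = h u"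
  shows "lin_ext g a = lin_ext h a"
  using assms(1)
  by (induction a rule: alg_induct) (simp_all add: lin_ext_add lin_ext_scale assms(2))

lemma monomial_inject [simp]:
  "monomial u = (monomial v :: ('z, 'o, 'k::zero_neq_one) alg) \<longleftrightarrow> u = v"
  by (metis keys_single monomial_def singleton_inject zero_neq_one)

lemma keys_monomial [simp]:
  "Poly_Mapping.keys (monomial u :: ('z, 'o, 'k::zero_neq_one) alg) = {u}"
  by (simp add: monomial_def)

lemma lin_ext_monomial_inj: "lin_ext monomial a = (a :: ('z, 'o, 'k::semiring_1) alg)"
  using subset_UNIV
  by (induction a rule: alg_induct) (simp_all add: lin_ext_add lin_ext_scale)

section \<open>Morphisms of operated algebras\<close>

lemma eval_mon_Nil [simp]: "eval_mon \<sigma> [] = 1"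
  and eval_mon_Cons: "eval_mon \<sigma> (x # u) = eval_letter \<sigma> x * eval_mon \<sigma> u"
  and eval_mon_append: "eval_mon \<sigma> (u @ v) = eval_mon \<sigma> u * eval_mon \<sigma> v"
  by (simp_all add: eval_mon_def)

lemma eval_letter_Br [simp]: "eval_letter \<sigma> (Br \<tau> u) = oper (Some \<tau>) (eval_mon \<sigma> u)"
  by (simp add: eval_mon_def)

declare eval_letter.simps(2) [simp del]

lemma eval_mon_Var [simp]: "eval_mon \<sigma> [Var z] = \<sigma> z"
  and eval_mon_Br [simp]: "eval_mon \<sigma> [Br \<tau> u] = oper (Some \<tau>) (eval_mon \<sigma> u)"
  by (simp_all add: eval_mon_Cons)

text \<open>Monomials are lists of letters that again contain monomials. Generating them from single letters
  by products and brackets replaces the simultaneous induction on letters and lists.\<close>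

lemma mon_induct [case_names Nil Var Br append]:
  assumes "P []" "\<And>z. P [Var z]" "\<And>\<tau> u. P u \<Longrightarrow> P [Br \<tau> u]"
    and "\<And>u v. P u \<Longrightarrow> P v \<Longrightarrow> P (u @ v)"
  shows "P (w :: ('z, 'o) mon)"
proof -
  have *: "P u" if "\<And>x. x \<in> set u \<Longrightarrow> P [x]" for u
    using that
  proof (induction u)
    case (Cons x u)
    then show ?case using assms(4)[of "[x]" u] by simp
  qed (rule assms(1))
  have "P [x]" for x
    by (induction x) (auto intro: assms *)
  then show ?thesis by (rule *)
qed

lemma hom_ext_monomial [simp]: "hom_ext \<sigma> (monomial u) = eval_mon \<sigma> u"
  by (simp add: hom_ext_def)

lemma hom_ext_one [simp]: "hom_ext \<sigma> 1 = 1"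
  by (metis hom_ext_monomial monomial_Nil eval_mon_Nil)

lemma hom_ext_mult:
  fixes a b :: "('z, 'o, 'k::comm_semiring_1) alg"
  shows "hom_ext \<sigma> (a * b) = hom_ext \<sigma> a * hom_ext \<sigma> b"
  unfolding hom_ext_def by (rule lin_ext_mult) (rule eval_mon_append)

lemma hom_ext_oper:
  fixes a :: "('z, 'o, 'k::comm_semiring_1) alg"
  shows "hom_ext \<sigma> (oper \<tau> a) = oper \<tau> (hom_ext \<sigma> a)"
  by (cases \<tau>) (simp_all add: hom_ext_def oper_def lin_ext_lin_ext lin_ext_monomial_inj)

lemma hom_ext_zero [simp]: "hom_ext \<sigma> 0 = 0"
  and hom_ext_add: "hom_ext \<sigma> (a + b) = hom_ext \<sigma> a + hom_ext \<sigma> b"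
  and hom_ext_scale: "hom_ext \<sigma> (scale c a) = scale c (hom_ext \<sigma> a)"
  by (simp_all add: hom_ext_def lin_ext_add lin_ext_scale)

lemma hom_ext_diff:
  "hom_ext \<sigma> (a - b :: ('z, 'o, 'k::ring_1) alg) = hom_ext \<sigma> a - hom_ext \<sigma> b"
  by (simp add: hom_ext_def lin_ext_diff)

lemma hom_ext_eval_mon:
  "hom_ext \<sigma> (eval_mon \<rho> w) = eval_mon (\<lambda>z. hom_ext \<sigma> (\<rho> z :: ('z, 'o, 'k::comm_semiring_1) alg)) w"
  by (induction w rule: mon_induct) (simp_all add: eval_mon_append hom_ext_mult hom_ext_oper)

lemma hom_ext_hom_ext:
  "hom_ext \<sigma> (hom_ext \<rho> a) =
    hom_ext (\<lambda>z. hom_ext \<sigma> (\<rho> z :: ('z, 'o, 'k::comm_semiring_1) alg)) a"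
proof -
  have "hom_ext \<sigma> (hom_ext \<rho> a) = lin_ext (\<lambda>u. hom_ext \<sigma> (eval_mon \<rho> u)) a"
    by (simp add: hom_ext_def lin_ext_lin_ext)
  then show ?thesis by (simp add: hom_ext_eval_mon hom_ext_def[of "\<lambda>z. hom_ext \<sigma> (\<rho> z)"])
qed

section \<open>Marked monomials and substitution\<close>

lemma free_mon_stage_mono: "free_mon_stage \<Omega> Z n \<subseteq> free_mon_stage \<Omega> Z (Suc n)"
proof (induction n)
  case (Suc n)
  then show ?case by (auto simp only: free_mon_stage.simps intro!: lists_mono)
      blast
qed (auto intro!: lists_mono)

lemma free_mon_stage_le: "m \<le> n \<Longrightarrow> free_mon_stage \<Omega> Z m \<subseteq> free_mon_stage \<Omega> Z n"
  by (rule lift_Suc_mono_le[of "free_mon_stage \<Omega> Z"]) (rule free_mon_stage_mono)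

lemma free_mon_stage_append:
  "u @ v \<in> free_mon_stage \<Omega> Z n \<longleftrightarrow> u \<in> free_mon_stage \<Omega> Z n \<and> v \<in> free_mon_stage \<Omega> Z n"
  by (cases n) auto

lemma free_mon_Nil [simp]: "[] \<in> free_mon \<Omega> Z"
  unfolding free_mon_def by (auto intro!: exI[of _ 0])

lemma free_mon_append [simp]:
  "u @ v \<in> free_mon \<Omega> Z \<longleftrightarrow> u \<in> free_mon \<Omega> Z \<and> v \<in> free_mon \<Omega> Z"
proof
  assume "u \<in> free_mon \<Omega> Z \<and> v \<in> free_mon \<Omega> Z"
  then obtain m n where "u \<in> free_mon_stage \<Omega> Z m" "v \<in> free_mon_stage \<Omega> Z n"
    by (auto simp: free_mon_def)
  then have "u @ v \<in> free_mon_stage \<Omega> Z (max m n)"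
    using free_mon_stage_le[of m "max m n" \<Omega> Z] free_mon_stage_le[of n "max m n" \<Omega> Z]
    by (auto simp: free_mon_stage_append)
  then show "u @ v \<in> free_mon \<Omega> Z" by (auto simp: free_mon_def)
qed (auto simp: free_mon_def free_mon_stage_append)

lemma free_mon_Var1: "[Var z] \<in> free_mon \<Omega> Z \<longleftrightarrow> z \<in> Z"
proof
  assume "[Var z] \<in> free_mon \<Omega> Z"
  then obtain n where "[Var z] \<in> free_mon_stage \<Omega> Z n" by (auto simp: free_mon_def)
  then show "z \<in> Z" by (cases n) auto
qed (auto simp: free_mon_def intro!: exI[of _ 0])

lemma free_mon_Br1: "[Br \<tau> u] \<in> free_mon \<Omega> Z \<longleftrightarrow> \<tau> \<in> \<Omega> \<and> u \<in> free_mon \<Omega> Z"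
proof
  assume "[Br \<tau> u] \<in> free_mon \<Omega> Z"
  then obtain n where "[Br \<tau> u] \<in> free_mon_stage \<Omega> Z n" by (auto simp: free_mon_def)
  then show "\<tau> \<in> \<Omega> \<and> u \<in> free_mon \<Omega> Z" by (cases n) (auto simp: free_mon_def)
next
  assume "\<tau> \<in> \<Omega> \<and> u \<in> free_mon \<Omega> Z"
  then obtain n where "\<tau> \<in> \<Omega>" "u \<in> free_mon_stage \<Omega> Z n" by (auto simp: free_mon_def)
  then have "[Br \<tau> u] \<in> free_mon_stage \<Omega> Z (Suc n)" by auto
  then show "[Br \<tau> u] \<in> free_mon \<Omega> Z" unfolding free_mon_def by blast
qed

lemma free_mon_Var [simp]: "Var z # u \<in> free_mon \<Omega> Z \<longleftrightarrow> z \<in> Z \<and> u \<in> free_mon \<Omega> Z"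
  and free_mon_Br [simp]:
    "Br \<tau> v # u \<in> free_mon \<Omega> Z \<longleftrightarrow> \<tau> \<in> \<Omega> \<and> v \<in> free_mon \<Omega> Z \<and> u \<in> free_mon \<Omega> Z"
  using free_mon_append[of "[Var z]" u \<Omega> Z] free_mon_append[of "[Br \<tau> v]" u \<Omega> Z]
  by (simp_all add: free_mon_Var1 free_mon_Br1 del: free_mon_append)

primrec subst_letter :: "('v \<Rightarrow> ('y, 'o) mon) \<Rightarrow> ('v, 'o) letter \<Rightarrow> ('y, 'o) mon" where
  "subst_letter \<sigma> (Var v) = \<sigma> v"
| "subst_letter \<sigma> (Br \<tau> w) = [Br \<tau> (concat (map (subst_letter \<sigma>) w))]"

definition subst :: "('v \<Rightarrow> ('y, 'o) mon) \<Rightarrow> ('v, 'o) mon \<Rightarrow> ('y, 'o) mon" where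
  "subst \<sigma> w = concat (map (subst_letter \<sigma>) w)"

lemma subst_Nil [simp]: "subst \<sigma> [] = []"
  and subst_append [simp]: "subst \<sigma> (u @ v) = subst \<sigma> u @ subst \<sigma> v"
  and subst_Var [simp]: "subst \<sigma> (Var z # u) = \<sigma> z @ subst \<sigma> u"
  and subst_Br [simp]: "subst \<sigma> (Br \<tau> v # u) = Br \<tau> (subst \<sigma> v) # subst \<sigma> u"
  by (simp_all add: subst_def)

lemma subst_subst: "subst \<sigma> (subst \<rho> w) = subst (\<lambda>v. subst \<sigma> (\<rho> v)) w"
  by (induction w rule: mon_induct) simp_all

lemma subst_Var_id [simp]: "subst (\<lambda>v. [Var v]) w = w"
  by (induction w rule: mon_induct) simp_all

lemma subst_in_free_mon:
  assumes "w \<in> free_mon \<Omega> V" "\<And>v. v \<in> V \<Longrightarrow> \<sigma> v \<in> free_mon \<Omega> W"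
  shows "subst \<sigma> w \<in> free_mon \<Omega> W"
  using assms(1) by (induction w rule: mon_induct) (simp_all add: assms(2))

text \<open>A monomial over \<^typ>\<open>'z + 'x\<close> is read as a monomial in the variables \<^typ>\<open>'z\<close> with marked positions.
  The marks may be generators, the hole of a context, or two holes in a prescribed order, so that
  one substitution operation serves one-monomials, contexts and Peiffer branchings alike.\<close>

primrec marks_letter :: "('z + 'x, 'o) letter \<Rightarrow> 'x list" where
  "marks_letter (Var v) = (case v of Inl z \<Rightarrow> [] | Inr x \<Rightarrow> [x])"
| "marks_letter (Br \<tau> w) = concat (map marks_letter w)"

definition marks :: "('z + 'x, 'o) mon \<Rightarrow> 'x list" where
  "marks w = concat (map marks_letter w)"

lemma marks_Nil [simp]: "marks [] = []"
  and marks_append [simp]: "marks (u @ v) = marks u @ marks v"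
  and marks_Inl [simp]: "marks (Var (Inl z) # u) = marks u"
  and marks_Inr [simp]: "marks (Var (Inr x) # u) = x # marks u"
  and marks_Br [simp]: "marks (Br \<tau> v # u) = marks v @ marks u"
  by (simp_all add: marks_def)

definition fill :: "('x \<Rightarrow> ('z + 'y, 'o) mon) \<Rightarrow> ('z + 'x, 'o) mon \<Rightarrow> ('z + 'y, 'o) mon" where
  "fill \<rho> = subst (case_sum (\<lambda>z. [Var (Inl z)]) \<rho>)"

definition embed :: "('z, 'o) mon \<Rightarrow> ('z + 'x, 'o) mon" where
  "embed = subst (\<lambda>z. [Var (Inl z)])"

lemma fill_Nil [simp]: "fill \<rho> [] = []"
  and fill_append [simp]: "fill \<rho> (u @ v) = fill \<rho> u @ fill \<rho> v"
  and fill_Inl [simp]: "fill \<rho> (Var (Inl z) # u) = Var (Inl z) # fill \<rho> u"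
  and fill_Inr [simp]: "fill \<rho> (Var (Inr x) # u) = \<rho> x @ fill \<rho> u"
  and fill_Br [simp]: "fill \<rho> (Br \<tau> v # u) = Br \<tau> (fill \<rho> v) # fill \<rho> u"
  by (simp_all add: fill_def)

lemma embed_Nil [simp]: "embed [] = []"
  and embed_append [simp]: "embed (u @ v) = embed u @ embed v"
  and embed_Var [simp]: "embed (Var z # u) = Var (Inl z) # embed u"
  and embed_Br [simp]: "embed (Br \<tau> v # u) = Br \<tau> (embed v) # embed u"
  by (simp_all add: embed_def)

lemma marked_induct [case_names Nil Inl Inr Br append]:
  assumes "P []" "\<And>z. P [Var (Inl z)]" "\<And>x. P [Var (Inr x)]" "\<And>\<tau> u. P u \<Longrightarrow> P [Br \<tau> u]"
    and "\<And>u v. P u \<Longrightarrow> P v \<Longrightarrow> P (u @ v)"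
  shows "P (w :: ('z + 'x, 'o) mon)"
proof (induction w rule: mon_induct)
  case (Var v)
  then show ?case by (cases v) (simp_all add: assms)
qed (simp_all add: assms)

lemma fill_fill: "fill \<rho> (fill \<rho>' w) = fill (\<lambda>x. fill \<rho> (\<rho>' x)) w"
  by (induction w rule: marked_induct) simp_all

lemma fill_embed [simp]: "fill \<rho> (embed w) = embed w"
  by (induction w rule: mon_induct) simp_all

lemma marks_embed [simp]: "marks (embed w) = []"
  by (induction w rule: mon_induct) simp_all

lemma fill_cong: "(\<And>x. x \<in> set (marks w) \<Longrightarrow> \<rho> x = \<rho>' x) \<Longrightarrow> fill \<rho> w = fill \<rho>' w"
  by (induction w rule: marked_induct) simp_all

lemma fill_Var_id [simp]: "fill (\<lambda>x. [Var (Inr x)]) w = w"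
  by (induction w rule: marked_induct) simp_all

lemma fill_id: "(\<And>x. x \<in> set (marks w) \<Longrightarrow> \<rho> x = [Var (Inr x)]) \<Longrightarrow> fill \<rho> w = w"
  using fill_cong[of w \<rho> "\<lambda>x. [Var (Inr x)]"] by simp

lemma marks_fill: "marks (fill \<rho> w) = concat (map (\<lambda>x. marks (\<rho> x)) (marks w))"
  by (induction w rule: marked_induct) simp_all

lemma fill_in_free_mon:
  assumes "w \<in> free_mon \<Omega> (Z <+> S)"
    and "\<And>x. x \<in> set (marks w) \<Longrightarrow> x \<in> S \<Longrightarrow> \<rho> x \<in> free_mon \<Omega> (Z <+> T)"
  shows "fill \<rho> w \<in> free_mon \<Omega> (Z <+> T)"
  using assms by (induction w rule: marked_induct) (simp_all add: Plus_def image_iff)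

lemma embed_in_free_mon [simp]: "embed w \<in> free_mon \<Omega> (Z <+> S) \<longleftrightarrow> w \<in> free_mon \<Omega> Z"
  by (induction w rule: mon_induct) (auto simp: Plus_def)

lemma set_marks: "w \<in> free_mon \<Omega> (Z <+> S) \<Longrightarrow> set (marks w) \<subseteq> S"
  by (induction w rule: marked_induct) (auto simp: Plus_def)

lemma embed_injective: "embed u = embed v \<Longrightarrow> u = v"
proof -
  have "subst (case_sum (\<lambda>z. [Var z]) (\<lambda>_. [])) (embed w) = w" for w :: "('z, 'o) mon"
    by (induction w rule: mon_induct) simp_all
  then show "embed u = embed v \<Longrightarrow> u = v" by metis
qed

text \<open>Two marked positions have an innermost bracket that contains both, and inside it they lie in
  different factors of a product. Everything outside is rebuilt by multiplying and bracketing. The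
  predicate \<open>p\<close> singles out the two positions among all marks.\<close>

lemma two_hole_induct [consumes 2, case_names split left right Br]:
  assumes "w \<in> free_mon \<Omega> (Z <+> S)" "filter p (marks w) = [a, b]"
    and "\<And>u v. \<lbrakk>u \<in> free_mon \<Omega> (Z <+> S); v \<in> free_mon \<Omega> (Z <+> S);
        filter p (marks u) = [a]; filter p (marks v) = [b]\<rbrakk> \<Longrightarrow> P (u @ v)"
    and "\<And>u v. \<lbrakk>u \<in> free_mon \<Omega> (Z <+> S); filter p (marks u) = []; P v\<rbrakk> \<Longrightarrow> P (u @ v)"
    and "\<And>u v. \<lbrakk>v \<in> free_mon \<Omega> (Z <+> S); filter p (marks v) = []; P u\<rbrakk> \<Longrightarrow> P (u @ v)"
    and "\<And>\<tau> u. \<lbrakk>\<tau> \<in> \<Omega>; P u\<rbrakk> \<Longrightarrow> P [Br \<tau> u]"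
  shows "P w"
  using assms(1,2)
proof (induction w rule: marked_induct)
  case (append u v)
  then consider "filter p (marks u) = []" "filter p (marks v) = [a, b]"
    | "filter p (marks u) = [a]" "filter p (marks v) = [b]"
    | "filter p (marks u) = [a, b]" "filter p (marks v) = []"
    by (auto simp: append_eq_Cons_conv)
  then show ?case
    using append assms(3-5) by cases auto
next
  case (Br \<tau> u)
  then show ?case using assms(6)[of \<tau> u] by simp
next
  case (Inr x)
  then show ?case by (cases "p x") simp_all
qed simp_all

section \<open>Balanced words\<close>

text \<open>Like the inverse of \<open>\<psi>\<close>, but on marked monomials; marks stay single letters.\<close>

primrec unbracket_letter :: "('z + 'x, 'o) letter \<Rightarrow> (('z, 'o) bletter + 'x, 'o) mon" where
  "unbracket_letter (Var v) = [Var (map_sum Letter id v)]"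
| "unbracket_letter (Br \<tau> w) =
    Var (Inl (LeftBr \<tau>)) # concat (map unbracket_letter w) @ [Var (Inl (RightBr \<tau>))]"

definition unbracket :: "('z + 'x, 'o) mon \<Rightarrow> (('z, 'o) bletter + 'x, 'o) mon" where
  "unbracket w = concat (map unbracket_letter w)"

definition psi_inv_mon :: "('z, 'o) mon \<Rightarrow> (('z, 'o) bletter, 'o) mon" where
  "psi_inv_mon w = concat (map flatten_letter w)"

lemma unbracket_Nil [simp]: "unbracket [] = []"
  and unbracket_append [simp]: "unbracket (u @ v) = unbracket u @ unbracket v"
  and unbracket_Inl [simp]: "unbracket (Var (Inl z) # u) = Var (Inl (Letter z)) # unbracket u"
  and unbracket_Inr [simp]: "unbracket (Var (Inr x) # u) = Var (Inr x) # unbracket u"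
  and unbracket_Br [simp]: "unbracket (Br \<tau> v # u) =
    Var (Inl (LeftBr \<tau>)) # unbracket v @ Var (Inl (RightBr \<tau>)) # unbracket u"
  by (simp_all add: unbracket_def)

lemma psi_inv_mon_Nil [simp]: "psi_inv_mon [] = []"
  and psi_inv_mon_append [simp]: "psi_inv_mon (u @ v) = psi_inv_mon u @ psi_inv_mon v"
  and psi_inv_mon_Var [simp]: "psi_inv_mon (Var z # u) = Var (Letter z) # psi_inv_mon u"
  and psi_inv_mon_Br [simp]:
    "psi_inv_mon (Br \<tau> v # u) = Var (LeftBr \<tau>) # psi_inv_mon v @ Var (RightBr \<tau>) # psi_inv_mon u"
  by (simp_all add: psi_inv_mon_def)

lemma unbracket_embed: "unbracket (embed w) = embed (psi_inv_mon w)"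
  by (induction w rule: mon_induct) simp_all

lemma unbracket_fill: "unbracket (fill \<rho> w) = fill (\<lambda>x. unbracket (\<rho> x)) (unbracket w)"
  by (induction w rule: marked_induct) simp_all

lemma marks_unbracket [simp]: "marks (unbracket w) = marks w"
  by (induction w rule: marked_induct) simp_all

definition bracket_letters :: "'o set \<Rightarrow> 'z set \<Rightarrow> ('z, 'o) bletter set" where
  "bracket_letters \<Omega> Z = Letter ` Z \<union> LeftBr ` \<Omega> \<union> RightBr ` \<Omega>"

lemma unbracket_in_free_mon [simp]:
  "unbracket w \<in> free_mon {} (bracket_letters \<Omega> Z <+> S) \<longleftrightarrow> w \<in> free_mon \<Omega> (Z <+> S)"
  by (induction w rule: marked_induct) (auto simp: bracket_letters_def Plus_def)

lemma psi_inv_mon_in_free_mon [simp]: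
  "psi_inv_mon w \<in> free_mon {} (bracket_letters \<Omega> Z) \<longleftrightarrow> w \<in> free_mon \<Omega> Z"
  by (induction w rule: mon_induct) (auto simp: bracket_letters_def)

text \<open>A word is read from left to right with the stack of brackets that are still open. Marks leave
  the stack alone, and so do balanced words: hence replacing marks by balanced words neither
  creates nor destroys balance (\<open>balanced_fill\<close>).\<close>

fun step :: "(('z, 'o) bletter + 'x, 'o) letter \<Rightarrow> 'o list \<Rightarrow> 'o list option" where
  "step (Var (Inl (LeftBr \<tau>))) st = Some (\<tau> # st)"
| "step (Var (Inl (RightBr \<tau>))) (\<sigma> # st) = (if \<sigma> = \<tau> then Some st else None)"
| "step (Var (Inl (RightBr \<tau>))) [] = None"
| "step (Var (Inl (Letter z))) st = Some st"
| "step (Var (Inr x)) st = Some st"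
| "step (Br \<tau> w) st = None"

primrec run :: "(('z, 'o) bletter + 'x, 'o) mon \<Rightarrow> 'o list \<Rightarrow> 'o list option" where
  "run [] st = Some st"
| "run (x # w) st = Option.bind (step x st) (run w)"

definition balanced :: "(('z, 'o) bletter + 'x, 'o) mon \<Rightarrow> bool" where
  "balanced w \<longleftrightarrow> run w [] = Some []"

lemma run_Nil_eq [simp]: "run [] = Some"
  by (rule ext) simp

lemma run_append: "run (u @ v) st = Option.bind (run u st) (run v)"
  by (induction u arbitrary: st) (simp_all, metis bind_assoc)

lemma step_extend: "step x st = Some st' \<Longrightarrow> step x (st @ t) = Some (st' @ t)"
  by (induction x st rule: step.induct) (auto split: if_splits)

lemma run_extend: "run w st = Some st' \<Longrightarrow> run w (st @ t) = Some (st' @ t)"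
proof (induction w arbitrary: st)
  case (Cons x w)
  then obtain s where "step x st = Some s" "run w s = Some st'"
    by (auto simp: bind_eq_Some_conv)
  then show ?case using step_extend[of x st s t] Cons.IH[of s] by simp
qed simp

lemma run_balanced: "balanced w \<Longrightarrow> run w st = Some st"
  using run_extend[of w "[]" "[]" st] by (simp add: balanced_def)

lemma balanced_Nil [simp]: "balanced []"
  and balanced_Inl_Letter [simp]: "balanced (Var (Inl (Letter z)) # w) \<longleftrightarrow> balanced w"
  and balanced_Inr [simp]: "balanced (Var (Inr x) # w) \<longleftrightarrow> balanced w"
  by (simp_all add: balanced_def)

lemma balanced_unbracket [simp]: "balanced (unbracket w)"
proof -
  have "run (unbracket w) st = Some st" for st
    by (induction w arbitrary: st rule: marked_induct) (simp_all add: run_append)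
  then show ?thesis by (simp add: balanced_def)
qed

lemma step_Inl: "step (Var (Inl z)) st = step (Var (Inl z)) st"
  by (cases z; cases st) simp_all

lemma run_fill:
  "(\<And>x. x \<in> set (marks w) \<Longrightarrow> balanced (\<rho> x)) \<Longrightarrow> run (fill \<rho> w) st = run w st"
proof (induction w arbitrary: st rule: marked_induct)
  case (append u v)
  then have "run (fill \<rho> v) = run v" by (intro ext) simp
  with append show ?case by (simp add: run_append)
next
  case (Inl z)
  show ?case by (simp, rule step_Inl)
qed (simp_all add: run_append run_balanced)

lemma balanced_fill:
  "(\<And>x. x \<in> set (marks w) \<Longrightarrow> balanced (\<rho> x)) \<Longrightarrow> balanced (fill \<rho> w) \<longleftrightarrow> balanced w"
  by (simp add: balanced_def run_fill)

lemma balanced_insert: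
  assumes "balanced s"
  shows "balanced (u @ s @ v) \<longleftrightarrow> balanced (u @ v)"
proof -
  have "run (s @ v) = run v" by (rule ext) (simp add: run_append run_balanced[OF assms])
  then show ?thesis by (simp add: balanced_def run_append[of u])
qed

text \<open>Two balanced words can only overlap in a balanced word. Reading \<open>y\<close> from the empty stack does
  not underflow, so reading it from the stack that \<open>x\<close> leaves keeps that stack at the bottom. As
  the result is empty, nothing was left open by \<open>x\<close>, nor by \<open>y\<close>.\<close>

lemma balanced_overlap:
  assumes "balanced (x @ y)" "balanced (y @ z)"
  shows "balanced (x @ y @ z)"
proof -
  obtain s where s: "run x [] = Some s" "run y s = Some []"
    using assms(1) by (auto simp: balanced_def run_append bind_eq_Some_conv)
  obtain t where t: "run y [] = Some t" "run z t = Some []"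
    using assms(2) by (auto simp: balanced_def run_append bind_eq_Some_conv)
  have "t @ s = []" using run_extend[OF t(1), of s] s(2) by simp
  with s t show ?thesis by (simp add: balanced_def run_append)
qed

text \<open>The shape of a prefix of a balanced word: monomials separated by brackets that are still open,
  the innermost bracket standing at the head of the list.\<close>

primrec open_brackets :: "('o \<times> ('z + 'x, 'o) mon) list \<Rightarrow> (('z, 'o) bletter + 'x, 'o) mon" where
  "open_brackets [] = []"
| "open_brackets (p # ps) = open_brackets ps @ unbracket (snd p) @ [Var (Inl (LeftBr (fst p)))]"

lemma run_decompose:
  "run w [] = Some st \<Longrightarrow> \<exists>ps u. st = map fst ps \<and> w = open_brackets ps @ unbracket u"
proof (induction w arbitrary: st rule: rev_induct)
  case Nil
  then have "st = map fst []" "[] = open_brackets [] @ unbracket []" by simp_all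
  then show ?case by blast
next
  case (snoc x w)
  then obtain st0 where st0: "run w [] = Some st0" "step x st0 = Some st"
    by (cases "run w []") (simp_all add: run_append)
  then obtain ps u where w: "st0 = map fst ps" "w = open_brackets ps @ unbracket u"
    using snoc.IH by blast
  consider (left) \<tau> where "x = Var (Inl (LeftBr \<tau>))" "st = \<tau> # st0"
    | (right) \<tau> where "x = Var (Inl (RightBr \<tau>))" "st0 = \<tau> # st"
    | (other) y where "[x] = unbracket y" "st = st0"
  proof (cases "(x, st0)" rule: step.cases)
    case (4 z st')
    then have "[x] = unbracket [Var (Inl z)]" "st = st0" using st0(2) by simp_all
    then show ?thesis by (rule other)
  next
    case (5 y st')
    then have "[x] = unbracket [Var (Inr y)]" "st = st0" using st0(2) by simp_all
    then show ?thesis by (rule other)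
  qed (use st0(2) left right in \<open>auto split: if_splits\<close>)
  then show ?case
  proof cases
    case left
    then have "st = map fst ((\<tau>, u) # ps)" "w @ [x] = open_brackets ((\<tau>, u) # ps) @ unbracket []"
      using w by simp_all
    then show ?thesis by blast
  next
    case right
    then obtain v ps' where "ps = (\<tau>, v) # ps'" using w by (cases ps) auto
    with right w have "st = map fst ps'" "w @ [x] = open_brackets ps' @ unbracket (v @ [Br \<tau> u])"
      by simp_all
    then show ?thesis by blast
  next
    case other
    then have "st = map fst ps" "w @ [x] = open_brackets ps @ unbracket (u @ y)" using w by simp_all
    then show ?thesis by blast
  qed
qed

lemma balanced_iff_unbracket: "balanced w \<longleftrightarrow> (\<exists>u. w = unbracket u)"
proof
  assume "balanced w"
  then show "\<exists>u. w = unbracket u"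
    using run_decompose[of w "[]"] by (auto simp: balanced_def)
qed auto

text \<open>A left inverse of \<^const>\<open>unbracket\<close>, from which injectivity follows. On words that close a bracket
  without having opened it the result is meaningless.\<close>

fun parse_step :: "(('z, 'o) bletter + 'x, 'o) letter \<Rightarrow>
    ('z + 'x, 'o) mon list \<times> ('z + 'x, 'o) mon \<Rightarrow> ('z + 'x, 'o) mon list \<times> ('z + 'x, 'o) mon" where
  "parse_step (Var (Inl (LeftBr \<tau>))) (us, u) = (u # us, [])"
| "parse_step (Var (Inl (RightBr \<tau>))) (us, u) = (tl us, hd us @ [Br \<tau> u])"
| "parse_step (Var (Inl (Letter z))) (us, u) = (us, u @ [Var (Inl z)])"
| "parse_step (Var (Inr x)) (us, u) = (us, u @ [Var (Inr x)])"
| "parse_step (Br \<tau> w) s = s"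

lemma parse_unbracket: "fold parse_step (unbracket w) (us, u) = (us, u @ w)"
  by (induction w arbitrary: us u rule: marked_induct) simp_all

lemma unbracket_inject [simp]: "unbracket u = unbracket v \<longleftrightarrow> u = v"
  by (metis parse_unbracket append_Nil prod.inject)

lemma psi_inv_mon_inject [simp]: "psi_inv_mon u = psi_inv_mon v \<longleftrightarrow> u = v"
  by (metis unbracket_embed unbracket_inject embed_injective)

section \<open>Contexts and one-monomials as marked monomials\<close>

lemma oper_monomial [simp]:
  "oper \<tau> (monomial u) = (monomial (bracket \<tau> u) :: ('z, 'o, 'k::semiring_1) alg)"
  by (simp add: oper_def)

lemma eval_mon_monomial:
  "eval_mon (\<lambda>v. monomial (\<sigma> v)) w = (monomial (subst \<sigma> w) :: ('z, 'o, 'k::semiring_1) alg)"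
  by (induction w rule: mon_induct) (simp_all add: eval_mon_append monomial_mult)

lemma hom_ext_id: "hom_ext (\<lambda>z. monomial [Var z]) a = (a :: ('z, 'o, 'k::comm_semiring_1) alg)"
proof -
  have "hom_ext (\<lambda>z. monomial [Var z]) a = lin_ext monomial a"
    unfolding hom_ext_def
    by (rule lin_ext_eqI[of _ UNIV]) (simp_all add: eval_mon_monomial)
  then show ?thesis by (simp add: lin_ext_monomial_inj)
qed

lemma idc_monomial [simp]:
  "idc (monomial u) = (monomial (embed u) :: ('z + 'g, 'o, 'k::field_char_0) alg)"
  by (simp add: idc_def embed_def eval_mon_monomial)

lemma idc_zero [simp]: "idc 0 = 0"
  by (simp add: idc_def)

definition mark_hole :: "('z option, 'o) mon \<Rightarrow> ('z + unit, 'o) mon" where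
  "mark_hole = subst (case_option [Var (Inr ())] (\<lambda>z. [Var (Inl z)]))"

lemma plug_monomial:
  "plug q (monomial u) = (monomial (fill (\<lambda>_. u) (mark_hole q)) ::
    ('z + 'g, 'o, 'k::field_char_0) alg)"
proof -
  have "case_option (monomial u) (\<lambda>z. monomial [Var (Inl z)]) =
      (\<lambda>v. monomial (case_option u (\<lambda>z. [Var (Inl z)]) v) :: ('z + 'g, 'o, 'k::field_char_0) alg)"
    by (auto split: option.split)
  moreover have "fill (\<lambda>_. u) (mark_hole q) = subst (case_option u (\<lambda>z. [Var (Inl z)])) q"
    by (auto simp: mark_hole_def fill_def subst_subst intro!: arg_cong[of _ _
      "\<lambda>s. subst s q"] split: option.split)
  ultimately show ?thesis by (simp add: plug_def eval_mon_monomial)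
qed

definition one_hole :: "'o set \<Rightarrow> 'z set \<Rightarrow> ('z + unit, 'o) mon set" where
  "one_hole \<Omega> Z = {q \<in> free_mon \<Omega> (Z <+> UNIV). marks q = [()]}"

lemma mark_hole_simps [simp]:
  "mark_hole [] = []" "mark_hole (u @ v) = mark_hole u @ mark_hole v"
  "mark_hole [Br \<tau> u] = [Br \<tau> (mark_hole u)]"
  "mark_hole [Var None] = [Var (Inr ())]" "mark_hole [Var (Some z)] = [Var (Inl z)]"
  by (simp_all add: mark_hole_def)

lemma length_marks_mark_hole: "length (marks (mark_hole q)) = sum_list (map holes q)"
proof (induction q rule: mon_induct)
  case (Var z)
  then show ?case by (cases z) simp_all
qed simp_all

lemma mark_hole_in_free_mon:
  "mark_hole q \<in> free_mon \<Omega> (Z <+> UNIV) \<longleftrightarrow> q \<in> free_mon \<Omega> (insert None (Some ` Z))"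
proof (induction q rule: mon_induct)
  case (Var z)
  then show ?case by (cases z) auto
qed simp_all

lemma ex_mark_hole: "\<exists>q'. q = mark_hole q'"
proof
  show "q = mark_hole (subst (case_sum (\<lambda>z. [Var (Some z)]) (\<lambda>_. [Var None])) q)"
    by (induction q rule: marked_induct) simp_all
qed

lemma inj_mark_hole: "inj mark_hole"
proof (rule inj_on_inverseI)
  show "subst (case_sum (\<lambda>z. [Var (Some z)]) (\<lambda>_. [Var None])) (mark_hole q) = q" for q
  proof (induction q rule: mon_induct)
    case (Var v)
    then show ?case by (cases v) simp_all
  qed simp_all
qed

lemma mark_hole_eq_hole: "mark_hole q = [Var (Inr ())] \<longleftrightarrow> q = hole"
proof -
  have "mark_hole hole = [Var (Inr ())]" by (simp add: hole_def)
  then show ?thesis using injD[OF inj_mark_hole, of q hole] by auto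
qed

lemma mark_hole_contexts: "mark_hole ` contexts \<Omega> Z = one_hole \<Omega> Z"
proof (intro equalityI subsetI)
  fix q assume "q \<in> mark_hole ` contexts \<Omega> Z"
  then obtain q' where q': "q = mark_hole q'" "q' \<in> contexts \<Omega> Z" by blast
  then have "length (marks q) = 1" by (simp add: length_marks_mark_hole contexts_def)
  then have "marks q = [()]" by (auto simp: length_Suc_conv)
  with q' show "q \<in> one_hole \<Omega> Z" by (auto simp: one_hole_def contexts_def mark_hole_in_free_mon)
next
  fix q assume q: "q \<in> one_hole \<Omega> Z"
  obtain q' where "q = mark_hole q'" using ex_mark_hole by blast
  with q length_marks_mark_hole[of q'] show "q \<in> mark_hole ` contexts \<Omega> Z"
    by (auto simp: one_hole_def contexts_def mark_hole_in_free_mon)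
qed

lemma fill_bracket [simp]: "fill \<rho> (bracket \<tau> u) = bracket \<tau> (fill \<rho> u)"
  and marks_bracket [simp]: "marks (bracket \<tau> u) = marks u"
  by (cases \<tau>; simp)+

lemma bracket_in_free_mon:
  "\<tau> \<in> insert None (Some ` \<Omega>) \<Longrightarrow> bracket \<tau> u \<in> free_mon \<Omega> Z \<longleftrightarrow> u \<in> free_mon \<Omega> Z"
  by (cases \<tau>) auto

text \<open>Substituting a generator for the hole of a context gives a monomial in which exactly one letter
  is a generator, and the context can be recovered from it (\<open>monomials1_eq\<close>).\<close>

definition mons1 :: "('z, 'o, 'g, 'k::field_char_0) polygraph \<Rightarrow> ('z + 'g, 'o) mon set" where
  "mons1 X = {u \<in> free_mon (ops X) (vars X <+> gens X). length (marks u) = 1}"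

lemma fill_const:
  "marks u = [\<alpha>] \<Longrightarrow> fill (\<lambda>_. \<rho> \<alpha>) u = fill \<rho> u"
  by (rule fill_cong) simp

lemma mons1_cases:
  assumes "u \<in> mons1 X"
  obtains \<alpha> where "\<alpha> \<in> gens X" "marks u = [\<alpha>]" "u \<in> free_mon (ops X) (vars X <+> gens X)"
proof -
  obtain \<alpha> where "marks u = [\<alpha>]" using assms by (auto simp: mons1_def length_Suc_conv)
  moreover have "u \<in> free_mon (ops X) (vars X <+> gens X)" using assms by (simp add: mons1_def)
  ultimately show ?thesis using that set_marks[of u] by auto
qed

lemma mons1_marks: "u \<in> mons1 X \<Longrightarrow> set (marks u) \<subseteq> gens X"
  by (erule mons1_cases) simp

lemma fill_mons1:
  assumes "q \<in> one_hole (ops X) (vars X)" "u \<in> mons1 X"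
  shows "fill (\<lambda>_. u) q \<in> mons1 X"
  using assms by (auto simp: mons1_def one_hole_def marks_fill intro: fill_in_free_mon)

lemma monomials1_eq:
  fixes X :: "('z, 'o, 'g, 'k::field_char_0) polygraph"
  shows "monomials1 X = monomial ` mons1 X"
proof (intro equalityI subsetI)
  fix f assume "f \<in> monomials1 X"
  then obtain q \<alpha> where q: "f = plug q (monomial [Var (Inr \<alpha>)])"
    "q \<in> contexts (ops X) (vars X)" "\<alpha> \<in> gens X"
    by (auto simp: monomials1_def)
  have "mark_hole q \<in> one_hole (ops X) (vars X)" using q(2) mark_hole_contexts by blast
  then show "f \<in> monomial ` mons1 X" using q(3)
    by (auto simp: q(1) plug_monomial intro!: imageI fill_mons1) (auto simp: mons1_def)
next
  fix f :: "('z + 'g, 'o, 'k) alg" assume "f \<in> monomial ` mons1 X"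
  then obtain u where u: "f = monomial u" "u \<in> mons1 X" by blast
  then obtain \<alpha> where \<alpha>: "\<alpha> \<in> gens X" "marks u = [\<alpha>]" "u \<in> free_mon (ops X) (vars X <+> gens X)"
    by (auto elim: mons1_cases)
  define q where "q = fill (\<lambda>_. [Var (Inr ())]) u"
  have "q \<in> one_hole (ops X) (vars X)"
    using \<alpha> by (auto simp: q_def one_hole_def marks_fill intro!: fill_in_free_mon)
  then obtain q' where q': "q = mark_hole q'" "q' \<in> contexts (ops X) (vars X)"
    unfolding mark_hole_contexts[symmetric] by blast
  have "fill (\<lambda>_. [Var (Inr \<alpha>)]) q = u"
    using \<alpha>(2) by (auto simp: q_def fill_fill intro!: fill_id)
  then have "f = plug q' (monomial [Var (Inr \<alpha>)])" by (simp add: plug_monomial u flip: q'(1))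
  with q' \<alpha> show "f \<in> monomials1 X" by (auto simp: monomials1_def)
qed

section \<open>Source, target and the exchange ideal\<close>

lemma source_idc [simp]: "source X (idc a) = a"
  and target_idc [simp]: "target X (idc a) = a"
  by (simp_all add: source_def target_def idc_def hom_ext_hom_ext hom_ext_id)

lemma source_linear [simp]: "source X 0 = 0" "source X (a + b) = source X a + source X b"
    "source X (a - b) = source X a - source X b" "source X (scale c a) = scale c (source X a)"
    "source X (a * b) = source X a * source X b" "source X (oper \<tau> a) = oper \<tau> (source X a)"
  and target_linear [simp]: "target X 0 = 0" "target X (a + b) = target X a + target X b"
    "target X (a - b) = target X a - target X b" "target X (scale c a) = scale c (target X a)"
    "target X (a * b) = target X a * target X b" "target X (oper \<tau> a) = oper \<tau> (target X a)"
  by (simp_all add: source_def target_def idc_def hom_ext_add hom_ext_diff hom_ext_scale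
      hom_ext_mult hom_ext_oper)

lemma idc_linear: "idc (a + b) = idc a + idc b"
    "idc (a - b) = idc a - idc b" "idc (scale c a) = scale c (idc a)"
    "idc (a * b) = idc a * idc b" "idc (oper \<tau> a) = oper \<tau> (idc a)"
  by (simp_all add: idc_def hom_ext_add hom_ext_diff hom_ext_scale hom_ext_mult hom_ext_oper)

lemma oper_zero [simp]: "oper \<tau> 0 = 0"
  and oper_diff: "oper \<tau> (a - b :: ('z, 'o, 'k::ring_1) alg) = oper \<tau> a - oper \<tau> b"
  by (simp_all add: oper_def lin_ext_diff)

text \<open>Both sides of the exchange law have the source \<open>source f * source g\<close>. Hence the source of a
  class of one-cells is well-defined, and it separates additive branchings from the others.\<close>

lemma source_exchange_ideal: "x \<in> exchange_ideal X \<Longrightarrow> source X x = 0"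
  by (induction rule: exchange_ideal.induct) (simp_all add: comp1_def)

lemma free_alg_zero [simp]: "0 \<in> free_alg \<Omega> Z"
  and free_alg_add: "a \<in> free_alg \<Omega> Z \<Longrightarrow> b \<in> free_alg \<Omega> Z \<Longrightarrow> a + b \<in> free_alg \<Omega> Z"
  using keys_add[of a b] by (auto simp: free_alg_def)

lemma free_alg_diff:
  "a \<in> free_alg \<Omega> Z \<Longrightarrow> b \<in> free_alg \<Omega> Z \<Longrightarrow> a - (b :: ('z, 'o, 'k::ring_1) alg) \<in> free_alg \<Omega> Z"
  using keys_diff[of a b] by (auto simp: free_alg_def)

lemma free_alg_mult:
  "a \<in> free_alg \<Omega> Z \<Longrightarrow> b \<in> free_alg \<Omega> Z \<Longrightarrow> a * (b :: ('z, 'o, 'k::semiring_1) alg) \<in> free_alg \<Omega> Z"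
  using keys_mult[of a b] by (fastforce simp: free_alg_def plus_list_def)

lemma free_alg_monomial [simp]:
  "(monomial u :: ('z, 'o, 'k::zero_neq_one) alg) \<in> free_alg \<Omega> Z \<longleftrightarrow> u \<in> free_mon \<Omega> Z"
  by (simp add: free_alg_def)

lemma free_alg_one [simp]: "(1 :: ('z, 'o, 'k::semiring_1) alg) \<in> free_alg \<Omega> Z"
  by (simp add: free_alg_def zero_list_def)

lemma free_alg_single: "u \<in> free_mon \<Omega> Z \<Longrightarrow> Poly_Mapping.single u c \<in> free_alg \<Omega> Z"
  by (simp add: free_alg_def)

lemma free_alg_scale:
  "a \<in> free_alg \<Omega> Z \<Longrightarrow> scale c (a :: ('z, 'o, 'k::semiring_1) alg) \<in> free_alg \<Omega> Z"
  using free_alg_mult[OF free_alg_single[of 0 \<Omega> Z c], of a]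
  by (simp add: scale_conv_mult zero_list_def)

lemma free_alg_lin_ext:
  assumes "a \<in> free_alg \<Omega> Z" "\<And>u. u \<in> free_mon \<Omega> Z \<Longrightarrow> h u \<in> free_alg \<Omega>' Z'"
  shows "lin_ext h (a :: ('z, 'o, 'k::semiring_1) alg) \<in> free_alg \<Omega>' Z'"
  using lin_ext_in[of a "free_mon \<Omega> Z" h "free_mon \<Omega>' Z'"] assms by (simp add: free_alg_def)

lemma free_alg_oper:
  "a \<in> free_alg \<Omega> Z \<Longrightarrow> \<tau> \<in> insert None (Some ` \<Omega>) \<Longrightarrow>
    oper \<tau> (a :: ('z, 'o, 'k::semiring_1) alg) \<in> free_alg \<Omega> Z"
  unfolding oper_def by (rule free_alg_lin_ext) (auto simp: bracket_in_free_mon)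

lemma idc_in_pre_cells1: "a \<in> free_alg (ops X) (vars X) \<Longrightarrow> idc a \<in> pre_cells1 X"
  unfolding pre_cells1_def idc_def hom_ext_def
  by (rule free_alg_lin_ext, assumption) (simp add: eval_mon_monomial flip: embed_def)

lemma pre_cells1_closed:
  "0 \<in> pre_cells1 X" "a \<in> pre_cells1 X \<Longrightarrow> b \<in> pre_cells1 X \<Longrightarrow> a + b \<in> pre_cells1 X"
  "a \<in> pre_cells1 X \<Longrightarrow> b \<in> pre_cells1 X \<Longrightarrow> a - b \<in> pre_cells1 X"
  "a \<in> pre_cells1 X \<Longrightarrow> b \<in> pre_cells1 X \<Longrightarrow> a * b \<in> pre_cells1 X"
  "a \<in> pre_cells1 X \<Longrightarrow> scale c a \<in> pre_cells1 X"
  by (simp_all add: pre_cells1_def free_alg_add free_alg_diff free_alg_mult free_alg_scale)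

lemma exchange_ideal_scale: "x \<in> exchange_ideal X \<Longrightarrow> scale c x \<in> exchange_ideal X"
  unfolding scale_conv_mult
  by (rule exchange_ideal.mult_left) (simp_all add: pre_cells1_def zero_list_def free_alg_single)

lemma exchange_ideal_zero [simp]: "0 \<in> exchange_ideal X"
  using exchange_ideal.exchange[of 0 X 0 0 0] by (simp add: pre_cells1_closed comp1_def)

lemma exchange_ideal_diff:
  assumes "x \<in> exchange_ideal X" "y \<in> exchange_ideal X"
  shows "x - y \<in> exchange_ideal X"
proof -
  have "scale (-1) y = - y" by (simp add: scale_conv_mult single_uminus)
  then show ?thesis using exchange_ideal.add[OF assms(1) exchange_ideal_scale[OF assms(2), of "-1"]]
    by simp
qed

lemma cell_eq_iff:
  assumes "f \<in> pre_cells1 X"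
  shows "cell X f = cell X g \<longleftrightarrow> f - g \<in> exchange_ideal X"
proof
  assume "cell X f = cell X g"
  moreover have "f \<in> cell X f" using assms by (simp add: cell_def)
  ultimately have "f \<in> cell X g" by simp
  then show "f - g \<in> exchange_ideal X" by (simp add: cell_def)
next
  assume *: "f - g \<in> exchange_ideal X"
  show "cell X f = cell X g"
  proof (intro equalityI subsetI)
    fix h assume "h \<in> cell X f"
    then show "h \<in> cell X g" using exchange_ideal.add[OF _ *, of "h - f"] by (simp add: cell_def)
  next
    fix h assume "h \<in> cell X g"
    then show "h \<in> cell X f" using exchange_ideal_diff[OF _ *, of "h - g"] by (simp add: cell_def)
  qed
qed

lemma source_cell:
  "f \<in> pre_cells1 X \<Longrightarrow> cell X f = cell X g \<Longrightarrow> source X f = source X g"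
  using source_exchange_ideal[of "f - g" X] by (simp add: cell_eq_iff)

section \<open>Branchings in terms of monomials\<close>

locale monomial_polygraph =
  fixes X :: "('z, 'o, 'g, 'k::field_char_0) polygraph"
  assumes left_monomial: "left_monomial_polygraph X"
begin

definition src_mon :: "'g \<Rightarrow> ('z, 'o) mon" where
  "src_mon \<alpha> = (THE u. src X \<alpha> = monomial u)"

lemma src_eqI: "src X \<alpha> = monomial u \<Longrightarrow> src_mon \<alpha> = u"
  by (simp add: src_mon_def)

lemma src_monomial:
  assumes "\<alpha> \<in> gens X"
  shows "src X \<alpha> = monomial (src_mon \<alpha>)" and "src_mon \<alpha> \<in> free_mon (ops X) (vars X)"
  using left_monomial assms src_eqI by (fastforce simp: left_monomial_polygraph_def)+

definition source_mon :: "('z + 'g, 'o) mon \<Rightarrow> ('z, 'o) mon" where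
  "source_mon = subst (case_sum (\<lambda>z. [Var z]) src_mon)"

lemma source_monomial:
  "u \<in> free_mon (ops X) (vars X <+> gens X) \<Longrightarrow> source X (monomial u) = monomial (source_mon u)"
  by (induction u rule: marked_induct)
    (auto simp: source_def source_mon_def eval_mon_append monomial_mult src_monomial)

lemma embed_source_mon: "embed (source_mon u) = fill (\<lambda>\<alpha>. embed (src_mon \<alpha>)) u"
  by (induction u rule: marked_induct) (simp_all add: source_mon_def)

lemma source_mons1: "u \<in> mons1 X \<Longrightarrow> source X (monomial u) = monomial (source_mon u)"
  by (simp add: mons1_def source_monomial)

lemma source_mon_in_free_mon:
  "u \<in> free_mon (ops X) (vars X <+> gens X) \<Longrightarrow> source_mon u \<in> free_mon (ops X) (vars X)"
  unfolding source_mon_def by (rule subst_in_free_mon) (auto simp: src_monomial)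

lemma mons1_pre_cells1: "u \<in> mons1 X \<Longrightarrow> monomial u \<in> pre_cells1 X"
  by (simp add: mons1_def pre_cells1_def)

text \<open>Different monomials may represent the same one-cell: for \<open>\<alpha> : u \<rightarrow> 0\<close> and \<open>\<beta> : v \<rightarrow> 0\<close> the
  exchange law identifies \<open>\<alpha>v\<close> with \<open>u\<beta>\<close>. All conditions on branchings are therefore conditions up
  to this relation.\<close>

definition same_cell :: "('z + 'g, 'o) mon \<Rightarrow> ('z + 'g, 'o) mon \<Rightarrow> bool" where
  "same_cell u v \<longleftrightarrow> cell X (monomial u) = cell X (monomial v)"

lemma same_cell_source_mon:
  "same_cell u v \<Longrightarrow> u \<in> mons1 X \<Longrightarrow> v \<in> mons1 X \<Longrightarrow> source_mon u = source_mon v"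
  using source_cell[of "monomial u" X "monomial v"]
  by (simp add: same_cell_def source_mons1 mons1_pre_cells1)

text \<open>A Peiffer pair is given by a monomial with a left mark \<^term>\<open>False\<close> and a right mark \<^term>\<open>True\<close>. Each
  of its two cells puts a generator at one of the marks and the source of the other generator at
  the other.\<close>

definition rewrite_left :: "'g \<Rightarrow> 'g \<Rightarrow> bool \<Rightarrow> ('z + 'g, 'o) mon" where
  "rewrite_left \<alpha> \<beta> b = (if b then embed (src_mon \<beta>) else [Var (Inr \<alpha>)])"

definition rewrite_right :: "'g \<Rightarrow> 'g \<Rightarrow> bool \<Rightarrow> ('z + 'g, 'o) mon" where
  "rewrite_right \<alpha> \<beta> b = (if b then [Var (Inr \<beta>)] else embed (src_mon \<alpha>))"

definition peiffer_mons :: "('z + 'g, 'o) mon \<Rightarrow> ('z + 'g, 'o) mon \<Rightarrow> bool" where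
  "peiffer_mons u v \<longleftrightarrow> (\<exists>q \<alpha> \<beta>. q \<in> free_mon (ops X) (vars X <+> UNIV) \<and> marks q = [False, True] \<and>
     \<alpha> \<in> gens X \<and> \<beta> \<in> gens X \<and> u = fill (rewrite_left \<alpha> \<beta>) q \<and> v = fill (rewrite_right \<alpha> \<beta>) q)"

lemma peiffer_mons_mons1:
  assumes "peiffer_mons u v"
  shows "u \<in> mons1 X" "v \<in> mons1 X"
  using assms
  by (auto simp: peiffer_mons_def mons1_def marks_fill rewrite_left_def rewrite_right_def
    src_monomial intro!: fill_in_free_mon)

lemma peiffer_mons_context:
  assumes "q \<in> one_hole (ops X) (vars X)" "u \<in> mons1 X" "v \<in> mons1 X"
    "\<tau> \<in> insert None (Some ` ops X)"
  shows "peiffer_mons (fill (\<lambda>_. bracket \<tau> (u @ embed (source_mon v))) q)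
    (fill (\<lambda>_. bracket \<tau> (embed (source_mon u) @ v)) q)"
proof -
  obtain \<alpha> where \<alpha>: "\<alpha> \<in> gens X" "marks u = [\<alpha>]" "u \<in> free_mon (ops X) (vars X <+> gens X)"
    using assms(2) by (rule mons1_cases)
  obtain \<beta> where \<beta>: "\<beta> \<in> gens X" "marks v = [\<beta>]" "v \<in> free_mon (ops X) (vars X <+> gens X)"
    using assms(3) by (rule mons1_cases)
  define Q where
    "Q = fill (\<lambda>_. bracket \<tau> (fill (\<lambda>_. [Var (Inr False)]) u @ fill (\<lambda>_. [Var (Inr True)]) v)) q"
  have "Q \<in> free_mon (ops X) (vars X <+> UNIV)" "marks Q = [False, True]"
    using assms(1,4) \<alpha> \<beta>
    by (auto simp: Q_def one_hole_def bracket_in_free_mon marks_fill intro!: fill_in_free_mon)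
  moreover have "fill (\<lambda>_. [Var (Inr \<alpha>)]) u = u" "fill (\<lambda>_. [Var (Inr \<beta>)]) v = v"
    using \<alpha> \<beta> by (auto intro: fill_id)
  then have "fill (rewrite_left \<alpha> \<beta>) Q = fill (\<lambda>_. bracket \<tau> (u @ embed (source_mon v))) q"
    "fill (rewrite_right \<alpha> \<beta>) Q = fill (\<lambda>_. bracket \<tau> (embed (source_mon u) @ v)) q"
    using fill_const[OF \<alpha>(2), of "\<lambda>\<alpha>. embed (src_mon \<alpha>) :: ('z + 'g, 'o) mon"]
      fill_const[OF \<beta>(2), of "\<lambda>\<alpha>. embed (src_mon \<alpha>) :: ('z + 'g, 'o) mon"]
    by (simp_all add: Q_def fill_fill rewrite_left_def rewrite_right_def embed_source_mon)
  ultimately show ?thesis unfolding peiffer_mons_def using \<alpha>(1) \<beta>(1) by metis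
qed

lemma peiffer_mons_decompose:
  assumes "peiffer_mons u v"
  obtains q a b where "q \<in> one_hole (ops X) (vars X)" "a \<in> mons1 X" "b \<in> mons1 X"
    "u = fill (\<lambda>_. a @ embed (source_mon b)) q" "v = fill (\<lambda>_. embed (source_mon a) @ b) q"
proof -
  obtain Q \<alpha> \<beta> where Q: "Q \<in> free_mon (ops X) (vars X <+> UNIV)" "marks Q = [False, True]"
    and g: "\<alpha> \<in> gens X" "\<beta> \<in> gens X" and uv: "u = fill (rewrite_left \<alpha> \<beta>) Q"
      "v = fill (rewrite_right \<alpha> \<beta>) Q"
    using assms by (auto simp: peiffer_mons_def)
  from Q(2) have Q': "filter (\<lambda>_. True) (marks Q) = [False, True]" by simp
  have "\<exists>q a b. q \<in> one_hole (ops X) (vars X) \<and> a \<in> mons1 X \<and> b \<in> mons1 X \<and>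
    fill (rewrite_left \<alpha> \<beta>) Q = fill (\<lambda>_. a @ embed (source_mon b)) q \<and>
    fill (rewrite_right \<alpha> \<beta>) Q = fill (\<lambda>_. embed (source_mon a) @ b) q"
    using Q(1) Q'
  proof (induction Q rule: two_hole_induct)
    case (split s t)
    let ?q = "[Var (Inr ())] :: ('z + unit, 'o) mon"
    let ?a = "fill (\<lambda>_. [Var (Inr \<alpha>)]) s" and ?b = "fill (\<lambda>_. [Var (Inr \<beta>)]) t"
    have e: "marks s = [False]" "marks t = [True]" using split by simp_all
    have "?q \<in> one_hole (ops X) (vars X)" by (auto simp: one_hole_def)
    moreover have "?a \<in> mons1 X" "?b \<in> mons1 X"
      using split g by (auto simp: mons1_def marks_fill intro!: fill_in_free_mon)
    moreover have "fill (rewrite_left \<alpha> \<beta>) s = ?a" "fill (rewrite_right \<alpha> \<beta>) t = ?b"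
      "fill (rewrite_left \<alpha> \<beta>) t = fill (\<lambda>_. embed (src_mon \<beta>)) t"
      "fill (rewrite_right \<alpha> \<beta>) s = fill (\<lambda>_. embed (src_mon \<alpha>)) s"
      by (intro fill_cong; simp add: e rewrite_left_def rewrite_right_def)+
    then have "fill (rewrite_left \<alpha> \<beta>) (s @ t) = fill (\<lambda>_. ?a @ embed (source_mon ?b)) ?q"
      "fill (rewrite_right \<alpha> \<beta>) (s @ t) = fill (\<lambda>_. embed (source_mon ?a) @ ?b) ?q"
      by (simp_all add: embed_source_mon fill_fill)
    ultimately show ?case by blast
  next
    case (left s t)
    then obtain q a b where q: "q \<in> one_hole (ops X) (vars X)" "a \<in> mons1 X" "b \<in> mons1 X"
      "fill (rewrite_left \<alpha> \<beta>) t = fill (\<lambda>_. a @ embed (source_mon b)) q"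
      "fill (rewrite_right \<alpha> \<beta>) t = fill (\<lambda>_. embed (source_mon a) @ b) q" by blast
    have "fill (\<lambda>_. []) s @ q \<in> one_hole (ops X) (vars X)"
      using left q(1) by (auto simp: one_hole_def marks_fill intro!: fill_in_free_mon)
    moreover have "fill \<rho> s = fill \<rho>' (fill (\<lambda>_. []) s)" for \<rho> and \<rho>' :: "unit \<Rightarrow> ('z + 'g, 'o) mon"
      unfolding fill_fill using left by (intro fill_cong) simp
    ultimately show ?case using q by (metis fill_append)
  next
    case (right s t)
    then obtain q a b where q: "q \<in> one_hole (ops X) (vars X)" "a \<in> mons1 X" "b \<in> mons1 X"
      "fill (rewrite_left \<alpha> \<beta>) s = fill (\<lambda>_. a @ embed (source_mon b)) q"
      "fill (rewrite_right \<alpha> \<beta>) s = fill (\<lambda>_. embed (source_mon a) @ b) q" by blast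
    have "q @ fill (\<lambda>_. []) t \<in> one_hole (ops X) (vars X)"
      using right q(1) by (auto simp: one_hole_def marks_fill intro!: fill_in_free_mon)
    moreover have "fill \<rho> t = fill \<rho>' (fill (\<lambda>_. []) t)" for \<rho> and \<rho>' :: "unit \<Rightarrow> ('z + 'g, 'o) mon"
      unfolding fill_fill using right by (intro fill_cong) simp
    ultimately show ?case using q by (metis fill_append)
  next
    case (Br \<tau> s)
    then obtain q a b where q: "q \<in> one_hole (ops X) (vars X)" "a \<in> mons1 X" "b \<in> mons1 X"
      "fill (rewrite_left \<alpha> \<beta>) s = fill (\<lambda>_. a @ embed (source_mon b)) q"
      "fill (rewrite_right \<alpha> \<beta>) s = fill (\<lambda>_. embed (source_mon a) @ b) q" by blast
    moreover have "[Br \<tau> q] \<in> one_hole (ops X) (vars X)"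
      using Br q(1) by (auto simp: one_hole_def)
    ultimately show ?case
      by (intro exI[of _ "[Br \<tau> q]"] exI[of _ a] exI[of _ b]) simp
  qed
  then show ?thesis using that uv by metis
qed

lemma aspherical_iff:
  assumes "u \<in> mons1 X" "v \<in> mons1 X"
  shows "(cell X (monomial u), cell X (monomial v)) \<in> aspherical X \<longleftrightarrow> same_cell u v"
proof
  assume "same_cell u v"
  moreover have "(cell X (scale 1 (monomial u) + idc 0),
      cell X (scale 1 (monomial u) + idc 0)) \<in> aspherical X"
    unfolding aspherical_def mem_Collect_eq
    by (intro exI[of _ 1] exI[of _ "monomial u"] exI[of _ "source_mon u"] exI[of _ 0])
      (use assms in \<open>simp add: monomials1_eq source_mons1 cells0_def\<close>)
  ultimately show "(cell X (monomial u), cell X (monomial v)) \<in> aspherical X"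
    by (simp add: same_cell_def)
qed (auto simp: aspherical_def same_cell_def)

text \<open>The source of an additive branching has two monomials in its support, that of a one-monomial has
  one.\<close>

lemma not_additive:
  assumes "u \<in> mons1 X"
  shows "(cell X (monomial u), F) \<notin> additive X"
proof
  assume "(cell X (monomial u), F) \<in> additive X"
  then obtain \<kappa> \<mu> f s t c where *: "\<kappa> \<noteq> 0" "\<mu> \<noteq> 0" "source X f = monomial s" "s \<noteq> t"
      "s \<notin> Poly_Mapping.keys c" "t \<notin> Poly_Mapping.keys c"
    and "cell X (monomial u) = cell X (scale \<kappa> f + scale \<mu> (idc (monomial t)) + idc c)"
    unfolding additive_def by blast
  then have "source X (monomial u) = source X (scale \<kappa> f + scale \<mu> (idc (monomial t)) + idc c)"
    by (intro source_cell mons1_pre_cells1 assms)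
  then have eq: "Poly_Mapping.single (source_mon u) 1 =
      Poly_Mapping.single s \<kappa> + Poly_Mapping.single t \<mu> + c"
    using * assms by (simp only: source_linear source_idc source_mons1)
      (simp only: scale_monomial, simp add: monomial_def)
  have "Poly_Mapping.lookup (Poly_Mapping.single (source_mon u) (1 :: 'k)) s = \<kappa>"
    "Poly_Mapping.lookup (Poly_Mapping.single (source_mon u) (1 :: 'k)) t = \<mu>"
    unfolding eq using * by (simp_all add: lookup_add lookup_single in_keys_iff when_def)
  then show False using * by (auto simp: lookup_single when_def split: if_splits)
qed

text \<open>Comparing sources, a Peiffer branching whose cells are one-monomials has coefficient one and no
  summand besides.\<close>

lemma peiffer_iff:
  assumes "u \<in> mons1 X" "v \<in> mons1 X"
  shows "(cell X (monomial u), cell X (monomial v)) \<in> peiffer X \<longleftrightarrow>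
    (\<exists>u' v'. peiffer_mons u' v' \<and> same_cell u u' \<and> same_cell v v')"
proof
  assume "(cell X (monomial u), cell X (monomial v)) \<in> peiffer X"
  then obtain \<kappa> q \<tau> f g s t w c where *: "\<kappa> \<noteq> 0" "q \<in> contexts (ops X) (vars X)"
      "\<tau> \<in> insert None (Some ` ops X)" "f \<in> monomials1 X" "g \<in> monomials1 X"
      "source X f = monomial s" "source X g = monomial t"
      "source X (plug q (oper \<tau> (idc (monomial (s @ t))))) = monomial w"
      "w \<notin> Poly_Mapping.keys c"
    and cu: "cell X (monomial u) =
      cell X (scale \<kappa> (plug q (oper \<tau> (f * idc (monomial t)))) + idc c)"
    and cv: "cell X (monomial v) =
      cell X (scale \<kappa> (plug q (oper \<tau> (idc (monomial s) * g))) + idc c)"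
    unfolding peiffer_def by blast
  obtain a b where ab: "f = monomial a" "g = monomial b" "a \<in> mons1 X" "b \<in> mons1 X"
    using *(4,5) by (auto simp: monomials1_eq)
  have st: "s = source_mon a" "t = source_mon b" using *(6,7) ab by (simp_all add: source_mons1)
  define q' where "q' = mark_hole q"
  have q': "q' \<in> one_hole (ops X) (vars X)" using *(2) mark_hole_contexts by (auto simp: q'_def)
  define u' where "u' = fill (\<lambda>_. bracket \<tau> (a @ embed t)) q'"
  define v' where "v' = fill (\<lambda>_. bracket \<tau> (embed s @ b)) q'"
  have p: "peiffer_mons u' v'" unfolding u'_def v'_def st
    by (rule peiffer_mons_context) (use q' ab * in auto)
  have u': "plug q (oper \<tau> (f * idc (monomial t))) = monomial u'"
    and v': "plug q (oper \<tau> (idc (monomial s) * g)) = monomial v'"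
    by (simp_all add: ab monomial_mult plug_monomial u'_def v'_def q'_def)
  have "fill (\<lambda>_. bracket \<tau> (embed (s @ t))) q' \<in> free_mon (ops X) (vars X <+> gens X)"
    using q' *(3) ab st source_mon_in_free_mon
    by (auto simp: one_hole_def bracket_in_free_mon mons1_def intro!: fill_in_free_mon)
  then have "w = source_mon (fill (\<lambda>_. bracket \<tau> (embed (s @ t))) q')"
    using *(8) by (simp add: plug_monomial source_monomial flip: q'_def)
  then have "embed (source_mon u') = (embed w :: ('z + 'g, 'o) mon)"
    by (simp add: embed_source_mon u'_def fill_fill st)
  then have "source_mon u' = w" by (rule embed_injective)
  moreover have "source X (monomial u) = source X (scale \<kappa> (monomial u') + idc c)"
    using cu unfolding u' by (intro source_cell mons1_pre_cells1 assms)
  ultimately have eq: "Poly_Mapping.single (source_mon u) 1 = Poly_Mapping.single w \<kappa> + c"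
    using assms peiffer_mons_mons1[OF p]
    by (simp only: source_linear source_idc source_mons1)
      (simp only: scale_monomial, simp add: monomial_def)
  \<comment> \<open>The monomial \<open>w\<close> is not in the support of \<open>c\<close>, so its coefficient is \<open>\<kappa>\<close> on the right.\<close>
  have "Poly_Mapping.lookup (Poly_Mapping.single (source_mon u) (1 :: 'k)) w = \<kappa>"
    unfolding eq using * by (simp_all add: lookup_add lookup_single in_keys_iff when_def)
  then have "\<kappa> = 1" "source_mon u = w" using *
    by (auto simp: lookup_single when_def split: if_splits)
  with eq have "c = 0" by simp
  with \<open>\<kappa> = 1\<close> have "same_cell u u'" "same_cell v v'"
    using cu cv unfolding u' v' by (simp_all add: same_cell_def)
  with p show "\<exists>u' v'. peiffer_mons u' v' \<and> same_cell u u' \<and> same_cell v v'" by blast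
next
  assume "\<exists>u' v'. peiffer_mons u' v' \<and> same_cell u u' \<and> same_cell v v'"
  then obtain u' v' where p: "peiffer_mons u' v'" "same_cell u u'" "same_cell v v'" by blast
  from p(1) obtain q a b where q: "q \<in> one_hole (ops X) (vars X)" and ab: "a \<in> mons1 X"
    "b \<in> mons1 X"
    and uv: "u' = fill (\<lambda>_. a @ embed (source_mon b)) q"
      "v' = fill (\<lambda>_. embed (source_mon a) @ b) q"
    by (rule peiffer_mons_decompose)
  obtain q' where q': "q = mark_hole q'" "q' \<in> contexts (ops X) (vars X)"
    using q unfolding mark_hole_contexts[symmetric] by blast
  define w where "w = source_mon (fill (\<lambda>_. embed (source_mon a @ source_mon b)) q)"
  have "(cell X (scale 1 (plug q' (oper None (monomial a * idc (monomial (source_mon b))))) +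
    idc 0),
      cell X (scale 1 (plug q' (oper None (idc (monomial (source_mon a)) * monomial b))) +
        idc 0)) \<in> peiffer X"
    unfolding peiffer_def mem_Collect_eq
  proof (rule exI[of _ 1], rule exI[of _ q'], rule exI[of _ None], rule exI[of _ "monomial a"],
      rule exI[of _ "monomial b"], rule exI[of _ "source_mon a"],
      rule exI[of _ "source_mon b"], rule exI[of _ w],
      rule exI[of _ 0], intro conjI refl)
    have "fill (\<lambda>_. embed (source_mon a @ source_mon b)) q \<in> free_mon (ops X) (vars X <+> gens X)"
      using q ab source_mon_in_free_mon
      by (auto simp: one_hole_def mons1_def intro!: fill_in_free_mon)
    then show "source X (plug q' (oper None (idc (monomial (source_mon a @ source_mon b))))) =
      monomial w"
      by (simp add: plug_monomial w_def source_monomial flip: q'(1))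
  qed (use q'(2) ab in \<open>simp_all add: monomials1_eq source_mons1 cells0_def\<close>)
  moreover have "cell X (scale 1 (plug q' (oper None (monomial a *
    idc (monomial (source_mon b))))) + idc 0) =
      cell X (monomial u')"
    "cell X (scale 1 (plug q' (oper None (idc (monomial (source_mon a)) * monomial b))) + idc 0) =
      cell X (monomial v')"
    by (simp_all add: monomial_mult plug_monomial uv flip: q'(1))
  ultimately show "(cell X (monomial u), cell X (monomial v)) \<in> peiffer X"
    using p by (simp add: same_cell_def)
qed

text \<open>The branchings that a critical branching must not be: both cells arise by putting one-monomials
  into the same nontrivial context.\<close>

definition common_context :: "('z + 'g, 'o) mon \<Rightarrow> ('z + 'g, 'o) mon \<Rightarrow> bool" where
  "common_context u v \<longleftrightarrow> (\<exists>q a b. q \<in> one_hole (ops X) (vars X) \<and> q \<noteq> [Var (Inr ())] \<and>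
     a \<in> mons1 X \<and> b \<in> mons1 X \<and> same_cell u (fill (\<lambda>_. a) q) \<and> same_cell v (fill (\<lambda>_. b) q))"

lemma common_context_iff:
  "common_context u v \<longleftrightarrow> (\<exists>q f' g'. q \<in> contexts (ops X) (vars X) \<and> q \<noteq> hole \<and>
      f' \<in> monomials1 X \<and> g' \<in> monomials1 X \<and>
      cell X (monomial u) = cell X (plug q f') \<and> cell X (monomial v) = cell X (plug q g'))"
  unfolding common_context_def monomials1_eq mark_hole_contexts[symmetric] same_cell_def
  by (auto simp: plug_monomial mark_hole_eq_hole)

definition critical_mons :: "(('z + 'g, 'o) mon \<times> ('z + 'g, 'o) mon) set" where
  "critical_mons = {(u, v). u \<in> mons1 X \<and> v \<in> mons1 X \<and> source_mon u = source_mon v \<and>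
    \<not> same_cell u v \<and>
     (\<forall>u' v'. same_cell u u' \<longrightarrow> same_cell v v' \<longrightarrow> \<not> peiffer_mons u' v' \<and> \<not> peiffer_mons v' u') \<and>
       \<not> common_context u v}"

lemma overlapping_condition_iff:
  assumes "u \<in> mons1 X" "v \<in> mons1 X"
  shows "(cell X (monomial u), cell X (monomial v)) \<notin>
      aspherical X \<union> additive X \<union> peiffer X \<union> (peiffer X)\<inverse> \<longleftrightarrow>
    \<not> same_cell u v \<and>
    (\<forall>u' v'. same_cell u u' \<longrightarrow> same_cell v v' \<longrightarrow> \<not> peiffer_mons u' v' \<and> \<not> peiffer_mons v' u')"
  unfolding Un_iff converse_iff aspherical_iff[OF assms] peiffer_iff[OF assms]
    peiffer_iff[OF assms(2,1)]
  using not_additive[OF assms(1)] by blast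

lemma overlapping_iff:
  "overlapping X 1 0 = {(cell X (monomial u), cell X (monomial v)) | u v. u \<in> mons1 X \<and>
    v \<in> mons1 X \<and>
     source_mon u = source_mon v \<and> \<not> same_cell u v \<and>
     (\<forall>u' v'. same_cell u u' \<longrightarrow> same_cell v v' \<longrightarrow> \<not> peiffer_mons u' v' \<and> \<not> peiffer_mons v' u')}"
  (is "_ = ?R")
proof (intro equalityI subsetI)
  fix P assume "P \<in> overlapping X 1 0"
  then obtain f g w where P: "P = (cell X (scale 1 f + idc 0), cell X (scale 1 g + idc 0))"
    and fg: "f \<in> monomials1 X" "g \<in> monomials1 X" "source X f = monomial w"
      "source X g = monomial w"
    and n: "(cell X f, cell X g) \<notin> aspherical X \<union> additive X \<union> peiffer X \<union> (peiffer X)\<inverse>"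
    unfolding overlapping_def by blast
  from fg obtain u v where uv: "f = monomial u" "g = monomial v" "u \<in> mons1 X" "v \<in> mons1 X"
    by (auto simp: monomials1_eq)
  have "source_mon u = source_mon v" using fg(3,4) uv by (simp add: source_mons1)
  moreover have "P = (cell X (monomial u), cell X (monomial v))" using P uv by simp
  ultimately show "P \<in> ?R" using uv n[unfolded uv(1,2) overlapping_condition_iff[OF uv(3,4)]]
    by blast
next
  fix P assume "P \<in> ?R"
  then obtain u v where uv: "u \<in> mons1 X" "v \<in> mons1 X" and P:
    "P = (cell X (monomial u), cell X (monomial v))"
    and s: "source_mon u = source_mon v" and n: "\<not> same_cell u v \<and>
     (\<forall>u' v'. same_cell u u' \<longrightarrow> same_cell v v' \<longrightarrow> \<not> peiffer_mons u' v' \<and>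
       \<not> peiffer_mons v' u')" by blast
  have "P = (cell X (scale 1 (monomial u) + idc 0), cell X (scale 1 (monomial v) + idc 0))"
    using P by simp
  moreover have "monomial u \<in> monomials1 X" "monomial v \<in> monomials1 X"
    using uv by (simp_all add: monomials1_eq)
  moreover have "source X (monomial u) = monomial (source_mon u)"
    "source X (monomial v) = monomial (source_mon u)"
    using uv s by (simp_all add: source_mons1)
  moreover have "0 \<in> cells0 X" "source_mon u \<notin> Poly_Mapping.keys (0 :: ('z, 'o, 'k) alg)"
    by (simp_all add: cells0_def)
  ultimately show "P \<in> overlapping X 1 0"
    unfolding overlapping_def using n[folded overlapping_condition_iff[OF uv]] one_neq_zero[where
      'a = 'k]
    by blast
qed

lemma critical_branchings_eq:
  "critical_branchings X = (\<lambda>(u, v). (cell X (monomial u), cell X (monomial v))) ` critical_mons"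
  unfolding critical_branchings_def overlapping_iff critical_mons_def common_context_iff by auto

end

section \<open>Correspondence of the exchange ideals\<close>

text \<open>The map \<open>unbracket_alg\<close> carries the inverse of \<open>\<psi>\<close> over to one-cells; \<open>rebracket_alg\<close> is the
  left inverse of it that kills the unbalanced words.\<close>

definition unbracket_alg ::
  "('z + 'x, 'o, 'k::field_char_0) alg \<Rightarrow> (('z, 'o) bletter + 'x, 'o, 'k) alg" where
  "unbracket_alg = lin_ext (\<lambda>u. monomial (unbracket u))"

definition rebracket_alg ::
  "(('z, 'o) bletter + 'x, 'o, 'k::field_char_0) alg \<Rightarrow> ('z + 'x, 'o, 'k) alg" where
  "rebracket_alg = lin_ext (\<lambda>w. if balanced w then monomial (inv unbracket w) else 0)"

lemma unbracket_alg_linear: "unbracket_alg 0 = 0"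
    "unbracket_alg (a + b) = unbracket_alg a + unbracket_alg b"
    "unbracket_alg (a - b) = unbracket_alg a - unbracket_alg b"
    "unbracket_alg (scale c a) = scale c (unbracket_alg a)"
    "unbracket_alg (a * b) = unbracket_alg a * unbracket_alg b"
    "unbracket_alg (monomial u) = monomial (unbracket u)"
  and rebracket_alg_linear: "rebracket_alg 0 = 0"
    "rebracket_alg (a' + b') = rebracket_alg a' + rebracket_alg b'"
    "rebracket_alg (a' - b') = rebracket_alg a' - rebracket_alg b'"
    "rebracket_alg (scale c a') = scale c (rebracket_alg a')"
  and psi_inv_linear: "psi_inv 0 = 0" "psi_inv (a'' + b'') = psi_inv a'' + psi_inv b''"
    "psi_inv (scale c a'') = scale c (psi_inv a'')"
    "psi_inv (a'' * b'') = psi_inv a'' * psi_inv b''"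
    "psi_inv (monomial v) = monomial (psi_inv_mon v)"
  by (simp_all add: unbracket_alg_def rebracket_alg_def psi_inv_def lin_ext_add lin_ext_diff
    lin_ext_scale
      lin_ext_mult monomial_mult flip: psi_inv_mon_def)

lemma unbracket_alg_one [simp]: "unbracket_alg 1 = 1"
  and psi_inv_one [simp]: "psi_inv 1 = 1"
  using unbracket_alg_linear(6)[of "[]"] psi_inv_linear(5)[of "[]"] by simp_all

lemma rebracket_unbracket_alg [simp]: "rebracket_alg (unbracket_alg a) = a"
proof -
  have "inv unbracket (unbracket u) = u" for u :: "('a + 'b, 'c) mon"
    by (rule inv_f_f) (simp add: inj_def)
  then show ?thesis
    by (simp add: rebracket_alg_def unbracket_alg_def lin_ext_lin_ext lin_ext_monomial_inj)
qed

lemma lin_ext_surround: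
  fixes a :: "('z, 'o, 'k::field_char_0) alg"
  shows "lin_ext (\<lambda>u. monomial (l @ h u @ r)) a =
    monomial l * lin_ext (\<lambda>u. monomial (h u)) a * monomial r"
  using subset_UNIV
  by (induction a rule: alg_induct)
    (simp_all add: lin_ext_add lin_ext_scale algebra_simps scale_mult_left scale_mult_right
      monomial_mult)

lemma unbracket_alg_oper: "unbracket_alg (oper (Some \<tau>) a) =
    monomial [Var (Inl (LeftBr \<tau>))] * unbracket_alg a * monomial [Var (Inl (RightBr \<tau>))]"
  by (simp add: unbracket_alg_def oper_def lin_ext_lin_ext flip: lin_ext_surround)

lemma psi_inv_oper: "psi_inv (oper (Some \<tau>) a) =
    monomial [Var (LeftBr \<tau>)] * psi_inv a * monomial [Var (RightBr \<tau>)]"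
  by (simp add: psi_inv_def oper_def lin_ext_lin_ext flip: lin_ext_surround psi_inv_mon_def)

lemma unbracket_alg_idc: "unbracket_alg (idc a) = idc (psi_inv a)"
  using subset_UNIV
  by (induction a rule: alg_induct)
    (simp_all add: idc_linear unbracket_alg_linear psi_inv_linear unbracket_embed)

lemma keys_unbracket_alg: "Poly_Mapping.keys (unbracket_alg a) \<subseteq> Collect balanced"
  unfolding unbracket_alg_def by (rule lin_ext_in[of _ UNIV]) auto

text \<open>Source and target are the cases \<^term>\<open>d = src X\<close> and \<^term>\<open>d = tgt X\<close>.\<close>

definition boundary ::
    "('g \<Rightarrow> ('z, 'o, 'k) alg) \<Rightarrow> ('z + 'g, 'o, 'k::field_char_0) alg \<Rightarrow> ('z, 'o, 'k) alg" where
  "boundary d = hom_ext (case_sum (\<lambda>z. monomial [Var z]) d)"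

lemma source_boundary: "source X = boundary (src X)"
  and target_boundary: "target X = boundary (tgt X)"
  by (simp_all add: source_def target_def boundary_def fun_eq_iff)

lemma boundary_linear: "boundary d 0 = 0"
    "boundary d (a + b) = boundary d a + boundary d b"
    "boundary d (a - b) = boundary d a - boundary d b"
    "boundary d (scale c a) = scale c (boundary d a)"
    "boundary d (a * b) = boundary d a * boundary d b"
    "boundary d (oper \<tau> a) = oper \<tau> (boundary d a)"
  by (simp_all add: boundary_def hom_ext_add hom_ext_diff hom_ext_scale hom_ext_mult hom_ext_oper)

lemma boundary_monomial: "boundary d 1 = 1" "boundary d (monomial [Var (Inl z)]) = monomial [Var z]"
    "boundary d (monomial [Var (Inr x)]) = d x"
    "boundary d (monomial [Br \<tau> u]) = oper (Some \<tau>) (boundary d (monomial u))"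
  by (simp_all add: boundary_def)

lemma boundary_unbracket_alg:
  fixes a :: "('z + 'g, 'o, 'k::field_char_0) alg"
  shows "boundary (\<lambda>\<alpha>. psi_inv (d \<alpha>)) (unbracket_alg a) = psi_inv (boundary d a)"
proof -
  have "boundary (\<lambda>\<alpha>. psi_inv (d \<alpha>)) (unbracket_alg (monomial u)) =
    psi_inv (boundary d (monomial u))" for u
  proof (induction u rule: marked_induct)
    case Nil
    then show ?case by (simp add: boundary_monomial)
  next
    case (Br \<tau> u)
    have "unbracket_alg (monomial [Br \<tau> u] :: ('z + 'g, 'o, 'k) alg) =
      unbracket_alg (oper (Some \<tau>) (monomial u))" by simp
    then show ?case
      by (simp only: Br unbracket_alg_oper boundary_linear boundary_monomial psi_inv_oper)
  next
    case (append u v)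
    show ?case
      unfolding monomial_mult[of u v,
        symmetric] unbracket_alg_linear(5) boundary_linear(5) psi_inv_linear(4) append ..
  qed (simp_all add: unbracket_alg_linear boundary_linear boundary_monomial psi_inv_linear)
  note word = this
  show ?thesis
    using subset_UNIV[of "Poly_Mapping.keys a"]
  proof (induction a rule: alg_induct)
    case (monomial c u)
    show ?case unfolding unbracket_alg_linear(4) boundary_linear(4) psi_inv_linear(3) word ..
  qed (simp_all add: unbracket_alg_linear boundary_linear psi_inv_linear)
qed

text \<open>The exchange law for two composites in each of which one factor is zero. By the identity in
  \<open>rebracket_alg_exchange_ideal\<close> below, sums of such products are all that the exchange law
  yields.\<close>

lemma exchange_ideal_mult:
  assumes "f \<in> pre_cells1 X" "g \<in> pre_cells1 X"
    and "target X f = 0 \<and> source X g = 0 \<or> source X f = 0 \<and> target X g = 0"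
  shows "f * g \<in> exchange_ideal X"
  using assms(3)
proof
  assume "target X f = 0 \<and> source X g = 0"
  then show ?thesis using exchange_ideal.exchange[of f X 0 0 g] assms(1,2)
    by (simp add: pre_cells1_closed comp1_def)
next
  assume "source X f = 0 \<and> target X g = 0"
  then show ?thesis using exchange_ideal.exchange[of 0 X f g 0] assms(1,2)
    by (simp add: pre_cells1_closed comp1_def)
qed

definition fill_alg :: "('x \<Rightarrow> ('z + 'y, 'o, 'k) alg) \<Rightarrow> ('z + 'x, 'o) mon \<Rightarrow> ('z + 'y, 'o,
  'k::field_char_0) alg" where
  "fill_alg \<rho> = eval_mon (case_sum (\<lambda>z. monomial [Var (Inl z)]) \<rho>)"

lemma fill_alg_simps [simp]:
  "fill_alg \<rho> [] = 1" "fill_alg \<rho> (u @ v) = fill_alg \<rho> u * fill_alg \<rho> v"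
  "fill_alg \<rho> [Var (Inl z)] = monomial [Var (Inl z)]"
  "fill_alg \<rho> [Var (Inr x)] = \<rho> x" "fill_alg \<rho> [Br \<tau> u] = oper (Some \<tau>) (fill_alg \<rho> u)"
  by (simp_all add: fill_alg_def eval_mon_append)

lemma unbracket_alg_fill_alg:
  "unbracket_alg (fill_alg \<rho> u) = fill_alg (\<lambda>x. unbracket_alg (\<rho> x)) (unbracket u)"
proof (induction u rule: marked_induct)
  case (Br \<tau> u)
  have "unbracket [Br \<tau> u] = [Var (Inl (LeftBr \<tau>))] @ unbracket u @ [Var (Inl (RightBr \<tau>))]" by simp
  then show ?case by (simp only: fill_alg_simps unbracket_alg_oper Br mult.assoc)
qed (simp_all add: unbracket_alg_linear)

lemma fill_alg_in_free_alg:
  assumes "u \<in> free_mon \<Omega> (Z <+> S)" "\<And>x. x \<in> S \<Longrightarrow> \<rho> x \<in> free_alg \<Omega> (Z <+> T)"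
  shows "fill_alg \<rho> u \<in> free_alg \<Omega> (Z <+> T)"
  using assms(1)
proof (induction u rule: marked_induct)
  case Nil
  then show ?case using free_alg_monomial[of "[]"] by simp
next
  case (Br \<tau> u)
  then show ?case by (auto intro!: free_alg_oper)
qed (auto simp: assms(2) free_alg_mult)

lemma boundary_fill_alg_zero:
  "x \<in> set (marks u) \<Longrightarrow> boundary d (\<rho> x) = 0 \<Longrightarrow> boundary d (fill_alg \<rho> u) = 0"
  by (induction u rule: marked_induct) (auto simp: boundary_linear)

text \<open>At the innermost bracket around the two selected marks the element is a product of a factor
  killed by one boundary and a factor killed by the other; the surrounding operations preserve the
  ideal.\<close>

lemma fill_alg_two_hole:
  assumes "u \<in> free_mon (ops X) (vars X <+> S)" "\<And>x. x \<in> S \<Longrightarrow> \<rho> x \<in> pre_cells1 X"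
    and "filter p (marks u) = [a, b]"
    and "target X (\<rho> a) = 0 \<and> source X (\<rho> b) = 0 \<or> source X (\<rho> a) = 0 \<and> target X (\<rho> b) = 0"
  shows "fill_alg \<rho> u \<in> exchange_ideal X"
  using assms(1,3)
proof (induction u rule: two_hole_induct)
  case (split u v)
  have "set (filter p (marks u)) = {a}" "set (filter p (marks v)) = {b}"
    unfolding split by simp_all
  then have "a \<in> set (marks u)" "b \<in> set (marks v)" by auto
  moreover have "fill_alg \<rho> u \<in> pre_cells1 X" "fill_alg \<rho> v \<in> pre_cells1 X"
    using split assms(2) by (auto simp: pre_cells1_def intro: fill_alg_in_free_alg)
  ultimately show ?case
    using assms(4) boundary_fill_alg_zero[of a u _ \<rho>] boundary_fill_alg_zero[of b v _ \<rho>]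
    by (auto intro!: exchange_ideal_mult simp: source_boundary target_boundary)
next
  case (left u v)
  then show ?case using assms(2)
    by (auto simp: pre_cells1_def intro!: exchange_ideal.mult_left fill_alg_in_free_alg)
next
  case (right u v)
  then show ?case using assms(2)
    by (auto simp: pre_cells1_def intro!: exchange_ideal.mult_right fill_alg_in_free_alg)
next
  case (Br \<tau> u)
  then show ?case by (auto intro: exchange_ideal.oper)
qed

text \<open>The ideal generated by the differences \<open>\<alpha> - d \<alpha>\<close>. Without operators it contains the kernel of
  the boundary map, since the generators of a word can be replaced by their boundaries one by one.\<close>

inductive_set boundary_ideal ::
  "('z, 'o, 'g, 'k::field_char_0) polygraph \<Rightarrow> ('g \<Rightarrow> ('z, 'o, 'k) alg) \<Rightarrow>
    ('z + 'g, 'o, 'k) alg set" for X d where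
  zero: "0 \<in> boundary_ideal X d"
| add: "x \<in> boundary_ideal X d \<Longrightarrow> y \<in> boundary_ideal X d \<Longrightarrow> x + y \<in> boundary_ideal X d"
| gen: "\<alpha> \<in> gens X \<Longrightarrow> a \<in> pre_cells1 X \<Longrightarrow> b \<in> pre_cells1 X \<Longrightarrow>
    a * (monomial [Var (Inr \<alpha>)] - idc (d \<alpha>)) * b \<in> boundary_ideal X d"

lemma boundary_ideal_mult_left:
  "x \<in> boundary_ideal X d \<Longrightarrow> a \<in> pre_cells1 X \<Longrightarrow> a * x \<in> boundary_ideal X d"
  by (induction rule: boundary_ideal.induct)
    (auto simp: distrib_left boundary_ideal.zero boundary_ideal.add pre_cells1_closed
      boundary_ideal.gen simp flip: mult.assoc)

lemma boundary_ideal_mult_right: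
  "x \<in> boundary_ideal X d \<Longrightarrow> a \<in> pre_cells1 X \<Longrightarrow> x * a \<in> boundary_ideal X d"
  by (induction rule: boundary_ideal.induct)
    (auto simp: distrib_right boundary_ideal.zero boundary_ideal.add pre_cells1_closed
      boundary_ideal.gen mult.assoc[of _ _ a])

lemma boundary_ideal_scale: "x \<in> boundary_ideal X d \<Longrightarrow> scale c x \<in> boundary_ideal X d"
  unfolding scale_conv_mult
  by (rule boundary_ideal_mult_left) (simp_all add: pre_cells1_def zero_list_def free_alg_single)

lemma minus_boundary_in_boundary_ideal:
  fixes X :: "('z, 'o, 'g, 'k::field_char_0) polygraph"
  assumes "f \<in> pre_cells1 X" "ops X = {}" "\<And>\<alpha>. \<alpha> \<in> gens X \<Longrightarrow> d \<alpha> \<in> cells0 X"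
  shows "f - idc (boundary d f) \<in> boundary_ideal X d"
proof -
  have word: "monomial u - idc (boundary d (monomial u)) \<in> boundary_ideal X d \<and>
    idc (boundary d (monomial u)) \<in> pre_cells1 X"
    if "u \<in> free_mon {} (vars X <+> gens X)" for u
    using that
  proof (induction u rule: marked_induct)
    case Nil
    have "(1 :: ('z + 'g, 'o, 'k) alg) = monomial []" "idc 1 = (1 :: ('z + 'g, 'o, 'k) alg)"
      using idc_monomial[of "[]"] by simp_all
    then show ?case
      by (simp add: boundary_monomial boundary_ideal.zero) (simp add: pre_cells1_def)
  next
    case (Inl z)
    then show ?case by (auto simp: boundary_monomial boundary_ideal.zero pre_cells1_def)
  next
    case (Inr \<alpha>)
    then have "\<alpha> \<in> gens X" by auto
    then show ?case
      using boundary_ideal.gen[of \<alpha> X "monomial []" "monomial []" d] assms(3)[of \<alpha>]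
      by (auto simp: boundary_monomial cells0_def idc_in_pre_cells1) (simp_all add: pre_cells1_def)
  next
    case (append u v)
    have u: "monomial u \<in> pre_cells1 X" using append assms(2) by (auto simp: pre_cells1_def)
    \<comment> \<open>First the generators of \<open>v\<close> are replaced, then those of \<open>u\<close>.\<close>
    have eq: "monomial (u @ v) - idc (boundary d (monomial (u @ v))) =
        monomial u * (monomial v - idc (boundary d (monomial v))) +
        (monomial u - idc (boundary d (monomial u))) * idc (boundary d (monomial v))"
      by (simp add: boundary_linear idc_linear algebra_simps flip: monomial_mult)
    have "idc (boundary d (monomial (u @ v))) =
        idc (boundary d (monomial u)) * (idc (boundary d (monomial v)) :: ('z + 'g, 'o, 'k) alg)"
      by (simp add: boundary_linear idc_linear flip: monomial_mult)
    moreover have "monomial u * (monomial v - idc (boundary d (monomial v))) \<in> boundary_ideal X d"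
      using append u by (intro boundary_ideal_mult_left) auto
    moreover have "(monomial u - idc (boundary d (monomial u))) *
      idc (boundary d (monomial v)) \<in> boundary_ideal X d"
      using append by (intro boundary_ideal_mult_right) auto
    moreover have "idc (boundary d (monomial u)) * idc (boundary d (monomial v)) \<in> pre_cells1 X"
      using append by (intro pre_cells1_closed) auto
    ultimately show ?case unfolding eq by (auto intro: boundary_ideal.add)
  qed auto
  have "Poly_Mapping.keys f \<subseteq> free_mon {} (vars X <+> gens X)"
    using assms(1,2) by (simp add: pre_cells1_def free_alg_def)
  then show ?thesis
  proof (induction f rule: alg_induct)
    case zero
    then show ?case by (simp add: boundary_linear boundary_ideal.zero)
  next
    case (add x y)
    then show ?case using boundary_ideal.add[OF add]
      by (simp add: boundary_linear idc_linear algebra_simps)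
  next
    case (monomial c u)
    then have "scale c (monomial u - idc (boundary d (monomial u))) \<in> boundary_ideal X d"
      using word by (intro boundary_ideal_scale) auto
    then show ?case
      by (simp add: boundary_linear idc_linear) (simp add: scale_conv_mult right_diff_distrib)
  qed
qed

lemma linear_polygraph_of_simps [simp]:
  "ops (linear_polygraph_of X) = {}"
  "vars (linear_polygraph_of X) = bracket_letters (ops X) (vars X)"
  "gens (linear_polygraph_of X) = gens X"
  "src (linear_polygraph_of X) = (\<lambda>\<alpha>. psi_inv (src X \<alpha>))"
  "tgt (linear_polygraph_of X) = (\<lambda>\<alpha>. psi_inv (tgt X \<alpha>))"
  by (simp_all add: linear_polygraph_of_def bracket_letters_def)

lemma source_unbracket_alg:
  "source (linear_polygraph_of X) (unbracket_alg f) = psi_inv (source X f)"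
  and target_unbracket_alg: "target (linear_polygraph_of X) (unbracket_alg f) =
    psi_inv (target X f)"
  by (simp_all add: source_boundary target_boundary boundary_unbracket_alg)

lemma unbracket_alg_in_pre_cells1:
  "f \<in> pre_cells1 X \<Longrightarrow> unbracket_alg f \<in> pre_cells1 (linear_polygraph_of X)"
  unfolding pre_cells1_def unbracket_alg_def by (erule free_alg_lin_ext) simp

lemma psi_inv_in_cells0: "a \<in> cells0 X \<Longrightarrow> psi_inv a \<in> cells0 (linear_polygraph_of X)"
  unfolding cells0_def psi_inv_def psi_inv_mon_def[symmetric] by (erule free_alg_lin_ext) simp

lemma left_monomial_linear_polygraph_of:
  assumes "left_monomial_polygraph X"
  shows "left_monomial_polygraph (linear_polygraph_of X)"
  unfolding left_monomial_polygraph_def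
proof (rule ballI)
  fix \<alpha> assume "\<alpha> \<in> gens (linear_polygraph_of X)"
  then obtain u where t: "tgt X \<alpha> \<in> free_alg (ops X) (vars X)"
    and u: "u \<in> free_mon (ops X) (vars X)" "src X \<alpha> = monomial u" "u \<notin> Poly_Mapping.keys (tgt X \<alpha>)"
    using assms by (auto simp: left_monomial_polygraph_def)
  have "Poly_Mapping.keys (psi_inv (tgt X \<alpha>)) \<subseteq> psi_inv_mon ` Poly_Mapping.keys (tgt X \<alpha>)"
    unfolding psi_inv_def psi_inv_mon_def[symmetric] by (rule lin_ext_in[OF order.refl]) auto
  then have "psi_inv_mon u \<notin> Poly_Mapping.keys (psi_inv (tgt X \<alpha>))" using u(3) by auto
  moreover have "psi_inv (tgt X \<alpha>) \<in> cells0 (linear_polygraph_of X)"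
    using t by (intro psi_inv_in_cells0) (simp add: cells0_def)
  ultimately show "tgt (linear_polygraph_of X) \<alpha> \<in> free_alg (ops (linear_polygraph_of X)) (vars
    (linear_polygraph_of X)) \<and>
      (\<exists>u\<in>free_mon (ops (linear_polygraph_of X)) (vars (linear_polygraph_of X)).
        src (linear_polygraph_of X) \<alpha> = monomial u \<and>
          u \<notin> Poly_Mapping.keys (tgt (linear_polygraph_of X) \<alpha>))"
    using u by (auto simp: cells0_def psi_inv_linear intro!: bexI[of _ "psi_inv_mon u"])
qed

text \<open>Brackets become multiplication by the bracket letters, under which an ideal is closed.\<close>

lemma unbracket_alg_exchange_ideal:
  "x \<in> exchange_ideal X \<Longrightarrow> unbracket_alg x \<in> exchange_ideal (linear_polygraph_of X)"
proof (induction rule: exchange_ideal.induct)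
  case (exchange f f' g g')
  have "unbracket_alg (comp1 X f f' * comp1 X g g' - comp1 X (f * g) (f' * g')) =
    comp1 (linear_polygraph_of X) (unbracket_alg f) (unbracket_alg f') *
      comp1 (linear_polygraph_of X) (unbracket_alg g) (unbracket_alg g') -
    comp1 (linear_polygraph_of X) (unbracket_alg f * unbracket_alg g) (unbracket_alg f' *
      unbracket_alg g')"
    by (simp add: comp1_def unbracket_alg_linear unbracket_alg_idc target_unbracket_alg
      psi_inv_linear flip: target_unbracket_alg)
  then show ?case
    using exchange by (auto intro!: exchange_ideal.exchange unbracket_alg_in_pre_cells1
      simp: target_unbracket_alg source_unbracket_alg)
next
  case (oper \<tau> x)
  have "monomial [Var (Inl (LeftBr \<tau>))] \<in> pre_cells1 (linear_polygraph_of X)"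
    "monomial [Var (Inl (RightBr \<tau>))] \<in> pre_cells1 (linear_polygraph_of X)"
    using oper by (auto simp: pre_cells1_def bracket_letters_def)
  with oper show ?case
    unfolding unbracket_alg_oper by (intro exchange_ideal.mult_right exchange_ideal.mult_left)
qed (auto simp: unbracket_alg_linear intro: exchange_ideal.add exchange_ideal.mult_left
    exchange_ideal.mult_right unbracket_alg_in_pre_cells1)

text \<open>An unbalanced word stays unbalanced when balanced words are inserted.\<close>

lemma rebracket_alg_unbalanced:
  assumes "Poly_Mapping.keys a \<subseteq> Collect balanced" "Poly_Mapping.keys b \<subseteq> Collect balanced"
    and "\<not> balanced (u @ v @ w)"
  shows "rebracket_alg (monomial u * a * monomial v * b * monomial w) = 0"
  using assms(1)
proof (induction a rule: alg_induct)
  case (monomial c s)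
  show ?case using assms(2)
  proof (induction b rule: alg_induct)
    case (monomial d t)
    have "\<not> balanced (u @ s @ v @ t @ w)"
      using assms(3) monomial \<open>s \<in> Collect balanced\<close>
      by (simp add: balanced_insert[of s u] balanced_insert[of t "u @ v" w, simplified])
    then show ?case
      by (simp add: scale_mult_left scale_mult_right rebracket_alg_linear monomial_mult)
         (simp add: rebracket_alg_def scale_conv_mult)
  qed (simp_all add: distrib_left distrib_right rebracket_alg_linear)
qed (simp_all add: distrib_left distrib_right rebracket_alg_linear)

context monomial_polygraph
begin

lemma tgt_in_cells0: "\<alpha> \<in> gens X \<Longrightarrow> tgt X \<alpha> \<in> cells0 X"
  using left_monomial by (auto simp: left_monomial_polygraph_def cells0_def)

lemma src_in_cells0: "\<alpha> \<in> gens X \<Longrightarrow> src X \<alpha> \<in> cells0 X"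
  by (simp add: src_monomial cells0_def)

text \<open>In the exchange ideal one factor lies in the kernel of one boundary map and the other factor in
  the kernel of the other map, in either order.\<close>

definition opposite :: "('g \<Rightarrow> ('z, 'o, 'k) alg) \<Rightarrow> ('g \<Rightarrow> ('z, 'o, 'k) alg) \<Rightarrow> bool" where
  "opposite d e \<longleftrightarrow> d = tgt X \<and> e = src X \<or> d = src X \<and> e = tgt X"

text \<open>The words of such a product arise from one another by replacing generators by balanced words, so
  they are either all unbalanced, and the product is killed, or all balanced. In the second case
  the two generators are marks of a monomial with brackets, and the product comes from an element
  of the exchange ideal of the polygraph with operators.\<close>

lemma rebracket_alg_words:
  assumes "opposite d e" and g: "\<alpha> \<in> gens X" "\<beta> \<in> gens X"
    and uvw: "u @ v @ w \<in> free_mon {} (bracket_letters (ops X) (vars X) <+> gens X)"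
  shows "rebracket_alg (monomial u * (monomial [Var (Inr \<alpha>)] - idc (psi_inv (d \<alpha>))) * monomial v *
      (monomial [Var (Inr \<beta>)] - idc (psi_inv (e \<beta>))) * monomial w) \<in> exchange_ideal X"
    (is "rebracket_alg ?x \<in> _")
proof -
  define \<rho> :: "'g + bool \<Rightarrow> ('z + 'g, 'o, 'k) alg" where
    "\<rho> = case_sum (\<lambda>\<gamma>. monomial [Var (Inr \<gamma>)])
      (\<lambda>b. if b then monomial [Var (Inr \<beta>)] - idc (e \<beta>) else monomial [Var (Inr \<alpha>)] - idc (d \<alpha>))"
  have x: "?x = monomial u * unbracket_alg (\<rho> (Inr False)) * monomial v *
    unbracket_alg (\<rho> (Inr True)) * monomial w"
    by (simp add: \<rho>_def unbracket_alg_linear unbracket_alg_idc)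
  show ?thesis
  proof (cases "balanced (u @ v @ w)")
    case False
    then show ?thesis unfolding x
      by (simp add: rebracket_alg_unbalanced[OF keys_unbracket_alg keys_unbracket_alg])
  next
    case True
    \<comment> \<open>The letters \<open>Inr (Inl _)\<close> are the generators inside \<open>u\<close>, \<open>v\<close> and \<open>w\<close>, which remain fixed.\<close>
    define lift :: "(('z, 'o) bletter + 'g, 'o) mon \<Rightarrow> (('z, 'o) bletter + 'g + bool, 'o) mon"
      where "lift = fill (\<lambda>\<gamma>. [Var (Inr (Inl \<gamma>))])"
    define W where "W = lift u @ [Var (Inr (Inr False))] @ lift v @ [Var (Inr (Inr True))] @ lift w"
    have "balanced W \<longleftrightarrow> balanced (lift (u @ v @ w))"
      using balanced_insert[of "[Var (Inr (Inr False))]" "lift u"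
        "lift v @ [Var (Inr (Inr True))] @ lift w"]
        balanced_insert[of "[Var (Inr (Inr True))]" "lift u @ lift v" "lift w"]
      by (simp add: W_def lift_def)
    also have "\<dots> \<longleftrightarrow> balanced (u @ v @ w)" unfolding lift_def by (rule balanced_fill) simp
    finally have "balanced W" using True by simp
    then obtain Q where Q: "W = unbracket Q" by (auto simp: balanced_iff_unbracket)
    have "lift s \<in> free_mon {} (bracket_letters (ops X) (vars X) <+> (gens X <+> UNIV))"
      if "s \<in> free_mon {} (bracket_letters (ops X) (vars X) <+> gens X)" for s
      using that unfolding lift_def by (rule fill_in_free_mon) auto
    then have "W \<in> free_mon {} (bracket_letters (ops X) (vars X) <+> (gens X <+> UNIV))"
      using uvw by (auto simp: W_def)
    then have Q_free: "Q \<in> free_mon (ops X) (vars X <+> (gens X <+> UNIV))" by (simp add: Q)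
    have ex_lift: "filter (Not \<circ> isl) (marks (lift s)) = []" for s
      by (auto simp: lift_def marks_fill filter_empty_conv)
    have "filter (Not \<circ> isl) (marks Q) = filter (Not \<circ> isl) (marks W)" by (simp add: Q)
    then have ex: "filter (Not \<circ> isl) (marks Q) = [Inr False, Inr True]"
      by (simp add: W_def ex_lift)
    have "fill_alg (\<lambda>x. unbracket_alg (\<rho> x)) (lift s) = monomial s" for s
    proof (induction s rule: marked_induct)
      case (append s t)
      then show ?case by (simp add: lift_def flip: monomial_mult)
    qed (simp_all add: lift_def \<rho>_def unbracket_alg_linear)
    then have "?x = fill_alg (\<lambda>x. unbracket_alg (\<rho> x)) W" unfolding x W_def
      by (simp only: fill_alg_simps mult.assoc)
    then have eq: "rebracket_alg ?x = fill_alg \<rho> Q" by (simp add: Q flip: unbracket_alg_fill_alg)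
    show ?thesis unfolding eq using Q_free _ ex
    proof (rule fill_alg_two_hole)
      show "\<rho> x \<in> pre_cells1 X" if "x \<in> gens X <+> UNIV" for x
        using that g assms(1) src_in_cells0 tgt_in_cells0
        by (auto simp: \<rho>_def opposite_def cells0_def intro!: pre_cells1_closed idc_in_pre_cells1)
           (auto simp: pre_cells1_def)
      show "target X (\<rho> (Inr False)) = 0 \<and> source X (\<rho> (Inr True)) = 0 \<or>
          source X (\<rho> (Inr False)) = 0 \<and> target X (\<rho> (Inr True)) = 0"
        using assms(1) by (auto simp: \<rho>_def opposite_def) (simp_all add: source_boundary
          target_boundary boundary_monomial)
    qed
  qed
qed

lemma rebracket_alg_gens:
  assumes "opposite d e" "\<alpha> \<in> gens X" "\<beta> \<in> gens X"
    and "a \<in> pre_cells1 (linear_polygraph_of X)" "b \<in> pre_cells1 (linear_polygraph_of X)"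
      "c \<in> pre_cells1 (linear_polygraph_of X)"
  shows "rebracket_alg (a * (monomial [Var (Inr \<alpha>)] - idc (psi_inv (d \<alpha>))) * b *
      (monomial [Var (Inr \<beta>)] - idc (psi_inv (e \<beta>))) * c) \<in> exchange_ideal X"
    (is "rebracket_alg (a * ?x * b * ?y * c) \<in> _")
proof -
  define F where "F = free_mon ({} :: 'o set) (bracket_letters (ops X) (vars X) <+> gens X)"
  have keys: "Poly_Mapping.keys a \<subseteq> F" "Poly_Mapping.keys b \<subseteq> F" "Poly_Mapping.keys c \<subseteq> F"
    using assms(4-6) by (simp_all add: pre_cells1_def free_alg_def F_def)
  show ?thesis using keys(1)
  proof (induction a rule: alg_induct)
    case (monomial k u)
    show ?case using keys(2)
    proof (induction b rule: alg_induct)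
      case (monomial l v)
      show ?case using keys(3)
      proof (induction c rule: alg_induct)
        case (monomial m w)
        have "rebracket_alg (monomial u * ?x * monomial v * ?y * monomial w) \<in> exchange_ideal X"
          using \<open>u \<in> F\<close> \<open>v \<in> F\<close> \<open>w \<in> F\<close> assms(1-3) by (intro rebracket_alg_words) (auto simp: F_def)
        then show ?case
          by (simp add: scale_mult_left scale_mult_right rebracket_alg_linear exchange_ideal_scale
              del: monomial_inject)
      qed (simp_all add: distrib_left rebracket_alg_linear exchange_ideal.add)
    qed (simp_all add: distrib_left distrib_right rebracket_alg_linear exchange_ideal.add)
  qed (simp_all add: distrib_right rebracket_alg_linear exchange_ideal.add)
qed

lemma rebracket_alg_boundary_ideal:
  assumes "opposite d e" "x \<in> boundary_ideal (linear_polygraph_of X) (\<lambda>\<alpha>. psi_inv (d \<alpha>))"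
    "y \<in> boundary_ideal (linear_polygraph_of X) (\<lambda>\<alpha>. psi_inv (e \<alpha>))"
    "a \<in> pre_cells1 (linear_polygraph_of X)" "c \<in> pre_cells1 (linear_polygraph_of X)"
  shows "rebracket_alg (a * x * y * c) \<in> exchange_ideal X"
  using assms(2)
proof (induction rule: boundary_ideal.induct)
  case (gen \<alpha> a1 b1)
  show ?case using assms(3)
  proof (induction rule: boundary_ideal.induct)
    case (gen \<beta> a2 b2)
    have "rebracket_alg ((a * a1) * (monomial [Var (Inr \<alpha>)] - idc (psi_inv (d \<alpha>))) * (b1 * a2) *
      (monomial [Var (Inr \<beta>)] - idc (psi_inv (e \<beta>))) * (b2 * c)) \<in> exchange_ideal X"
      using gen \<open>\<alpha> \<in> gens (linear_polygraph_of X)\<close> \<open>a1 \<in> _\<close> \<open>b1 \<in> _\<close> assms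
      by (intro rebracket_alg_gens pre_cells1_closed) auto
    then show ?case by (simp only: mult.assoc)
  qed (simp_all add: distrib_left distrib_right rebracket_alg_linear exchange_ideal.add)
qed (simp_all add: distrib_left distrib_right rebracket_alg_linear exchange_ideal.add)

text \<open>The assertion is strengthened to products with arbitrary, possibly unbalanced, factors on both
  sides, since the ideal on the side of words is closed under these.\<close>

lemma rebracket_alg_exchange_ideal:
  assumes "x \<in> exchange_ideal (linear_polygraph_of X)"
  shows "rebracket_alg x \<in> exchange_ideal X"
proof -
  let ?S = "linear_polygraph_of X"
  have "\<forall>a\<in>pre_cells1 ?S. \<forall>c\<in>pre_cells1 ?S. rebracket_alg (a * x * c) \<in> exchange_ideal X"
    using assms
  proof (induction rule: exchange_ideal.induct)
    case (exchange f f' g g')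
    have bs: "h - idc (source ?S h) \<in> boundary_ideal ?S (\<lambda>\<alpha>. psi_inv (src X \<alpha>))"
      "h - idc (target ?S h) \<in> boundary_ideal ?S (\<lambda>\<alpha>. psi_inv (tgt X \<alpha>))" if
      "h \<in> pre_cells1 ?S" for h
      using that minus_boundary_in_boundary_ideal[of h ?S "\<lambda>\<alpha>. psi_inv (src X \<alpha>)"]
        minus_boundary_in_boundary_ideal[of h ?S "\<lambda>\<alpha>. psi_inv (tgt X \<alpha>)"]
        psi_inv_in_cells0 src_in_cells0 tgt_in_cells0
      by (auto simp: source_boundary target_boundary)
    \<comment> \<open>All mixed terms of the exchange law collect into two products of boundary differences.\<close>
    have eq: "comp1 ?S f f' * comp1 ?S g g' - comp1 ?S (f * g) (f' * g') =
      (f - idc (target ?S f)) * (g' - idc (source ?S g')) +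
      (f' - idc (source ?S f')) * (g - idc (target ?S g))"
      using exchange(5,6) by (simp add: comp1_def idc_linear algebra_simps)
    have o: "opposite (tgt X) (src X)" "opposite (src X) (tgt X)" by (auto simp: opposite_def)
    show ?case
    proof (intro ballI)
      fix a c assume ac: "a \<in> pre_cells1 ?S" "c \<in> pre_cells1 ?S"
      have "rebracket_alg (a * (f - idc (target ?S f)) * (g' - idc (source ?S g')) *
        c) \<in> exchange_ideal X"
        "rebracket_alg (a * (f' - idc (source ?S f')) * (g - idc (target ?S g)) *
          c) \<in> exchange_ideal X"
        by (rule rebracket_alg_boundary_ideal[OF o(1) bs(2) bs(1) ac]
          rebracket_alg_boundary_ideal[OF o(2) bs(1) bs(2) ac]; fact exchange)+
      then show "rebracket_alg (a * (comp1 ?S f f' * comp1 ?S g g' - comp1 ?S (f * g) (f' * g')) *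
        c)
          \<in> exchange_ideal X"
        unfolding eq by (simp add: distrib_left distrib_right rebracket_alg_linear
          exchange_ideal.add mult.assoc)
    qed
  next
    case (mult_left b x)
    then show ?case by (simp add: pre_cells1_closed flip: mult.assoc)
  next
    case (mult_right b x)
    then show ?case by (simp add: pre_cells1_closed mult.assoc)
  qed (simp_all add: distrib_left distrib_right rebracket_alg_linear exchange_ideal.add)
  moreover have "1 \<in> pre_cells1 ?S" by (simp add: pre_cells1_def)
  ultimately show ?thesis by fastforce
qed

lemma unbracket_alg_exchange_ideal_iff:
  "unbracket_alg x \<in> exchange_ideal (linear_polygraph_of X) \<longleftrightarrow> x \<in> exchange_ideal X"
  using rebracket_alg_exchange_ideal[of "unbracket_alg x"] unbracket_alg_exchange_ideal by auto

end

section \<open>Correspondence of the critical branchings\<close>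

lemma same_first_letter:
  assumes "unbracket u = Var (Inl x) # s" "unbracket v = Var (Inl x) # t"
  obtains (Var) z u' v' where "u = [Var (Inl z)] @ u'" "v = [Var (Inl z)] @ v'"
    | (Br) \<tau> a b u' v' where "u = [Br \<tau> a] @ u'" "v = [Br \<tau> b] @ v'"
proof (cases u)
  case Nil
  then show ?thesis using assms by simp
next
  case u: (Cons c u')
  obtain d v' where v: "v = d # v'" using assms by (cases v) auto
  show ?thesis
  proof (cases c)
    case c: (Var c')
    then obtain z where z: "c' = Inl z" "x = Letter z" using assms u by (cases c') auto
    then show ?thesis
    proof (cases d)
      case (Var d')
      then show ?thesis using that(1)[of z u' v'] u v c z assms by (cases d') auto
    qed (use assms v z in auto)
  next
    case c: (Br \<tau> a)
    then have "x = LeftBr \<tau>" using assms u by simp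
    then show ?thesis
    proof (cases d)
      case (Var d')
      then show ?thesis using \<open>x = LeftBr \<tau>\<close> v assms by (cases d') auto
    next
      case (Br \<tau>' b)
      then show ?thesis using \<open>x = LeftBr \<tau>\<close> that(2)[of \<tau> a u' b v'] u v c assms by simp
    qed
  qed
qed

lemma same_last_letter:
  assumes "unbracket u = s @ [Var (Inl x)]" "unbracket v = t @ [Var (Inl x)]"
  obtains (Var) z u' v' where "u = u' @ [Var (Inl z)]" "v = v' @ [Var (Inl z)]"
    | (Br) \<tau> a b u' v' where "u = u' @ [Br \<tau> a]" "v = v' @ [Br \<tau> b]"
proof (cases u rule: rev_cases)
  case Nil
  then show ?thesis using assms by simp
next
  case u: (snoc u' c)
  obtain d v' where v: "v = v' @ [d]" using assms by (cases v rule: rev_cases) auto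
  show ?thesis
  proof (cases c)
    case c: (Var c')
    then obtain z where z: "c' = Inl z" "x = Letter z" using assms u by (cases c') auto
    then show ?thesis
    proof (cases d)
      case (Var d')
      then show ?thesis using that(1)[of u' z v'] u v c z assms by (cases d') auto
    qed (use assms v z in auto)
  next
    case c: (Br \<tau> a)
    then have "x = RightBr \<tau>" using assms u by simp
    then show ?thesis
    proof (cases d)
      case (Var d')
      then show ?thesis using \<open>x = RightBr \<tau>\<close> v assms by (cases d') auto
    next
      case (Br \<tau>' b)
      then show ?thesis using \<open>x = RightBr \<tau>\<close> that(2)[of u' \<tau> a v' b] u v c assms by simp
    qed
  qed
qed

lemma word_no_marks:
  "u \<in> free_mon {} (V <+> S) \<Longrightarrow> marks u = [] \<Longrightarrow> \<exists>w. u = embed w"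
proof (induction u)
  case Nil
  then show ?case by (intro exI[of _ "[]"]) simp
next
  case (Cons c u)
  then obtain z where c: "c = Var (Inl z)"
    by (cases c; cases "case c of Var y \<Rightarrow> y") auto
  with Cons obtain w where "u = embed w" by auto
  then have "c # u = embed (Var z # w)" by (simp add: c)
  then show ?case by blast
qed

lemma word_one_mark:
  "u \<in> free_mon {} (V <+> S) \<Longrightarrow> marks u = [x] \<Longrightarrow> \<exists>w w'. u = embed w @ [Var (Inr x)] @ embed w'"
proof (induction u)
  case (Cons c u)
  then obtain y where c: "c = Var y" by (cases c) auto
  show ?case
  proof (cases y)
    case (Inl z)
    with Cons c obtain w w' where "u = embed w @ [Var (Inr x)] @ embed w'" by auto
    then have "c # u = embed (Var z # w) @ [Var (Inr x)] @ embed w'" by (simp add: c Inl)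
    then show ?thesis by blast
  next
    case (Inr x')
    with Cons c obtain w where "u = embed w" using word_no_marks[of u V S] by auto
    then have "c # u = embed [] @ [Var (Inr x)] @ embed w" using Cons by (simp add: c Inr)
    then show ?thesis by blast
  qed
qed simp

lemma ex_bij_betw_images:
  assumes "\<And>x y. x \<in> C \<Longrightarrow> y \<in> C \<Longrightarrow> f x = f y \<longleftrightarrow> g x = g y"
  shows "\<exists>\<phi>. bij_betw \<phi> (f ` C) (g ` C)"
proof (intro exI)
  have *: "g (inv_into C f (f x)) = g x" if "x \<in> C" for x
    using assms[of "inv_into C f (f x)" x] that by (simp add: inv_into_into f_inv_into_f)
  show "bij_betw (\<lambda>y. g (inv_into C f y)) (f ` C) (g ` C)"
    unfolding bij_betw_def inj_on_def using * assms by (auto simp: image_iff)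
qed

context monomial_polygraph
begin

lemma source_mon_append [simp]: "source_mon (u @ v) = source_mon u @ source_mon v"
  and source_mon_Inl [simp]: "source_mon (Var (Inl z) # u) = Var z # source_mon u"
  and source_mon_Inr [simp]: "source_mon (Var (Inr \<alpha>) # u) = src_mon \<alpha> @ source_mon u"
  and source_mon_Br [simp]: "source_mon (Br \<tau> v # u) = Br \<tau> (source_mon v) # source_mon u"
  and source_mon_Nil [simp]: "source_mon [] = []"
  by (simp_all add: source_mon_def)

lemma source_mon_embed [simp]: "source_mon (embed w) = w"
  by (induction w rule: mon_induct) simp_all

lemma embed_source_mon_id: "marks u = [] \<Longrightarrow> embed (source_mon u) = u"
  unfolding embed_source_mon by (rule fill_id) simp

lemma hole_one_hole [simp]: "[Var (Inr ())] \<in> one_hole (ops X) (vars X)"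
  by (auto simp: one_hole_def)

lemma same_cell_refl [simp]: "same_cell u u"
  by (simp add: same_cell_def)

text \<open>Two ways of rewriting a product whose sources agree factor by factor. If they rewrite different
  factors, they form a Peiffer pair; otherwise they coincide on the factor that is not rewritten.\<close>

lemma rewriting_positions:
  assumes "c1 @ d1 \<in> mons1 X" "c2 @ d2 \<in> mons1 X" "source_mon c1 = source_mon c2"
    "source_mon d1 = source_mon d2"
  obtains (peiffer_mons) "peiffer_mons (c1 @ d1) (c2 @ d2) \<or> peiffer_mons (c2 @ d2) (c1 @ d1)"
    | (left) "c1 \<in> mons1 X" "c2 \<in> mons1 X" "d1 = d2" "marks d1 = []"
      "d1 \<in> free_mon (ops X) (vars X <+> gens X)"
    | (right) "d1 \<in> mons1 X" "d2 \<in> mons1 X" "c1 = c2" "marks c1 = []"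
      "c1 \<in> free_mon (ops X) (vars X <+> gens X)"
proof -
  have pos: "c \<in> mons1 X \<and> marks d = [] \<or> d \<in> mons1 X \<and> marks c = []"
    if "c @ d \<in> mons1 X" for c d
    using that by (auto simp: mons1_def add_is_1)
  have peiffer_mons: "peiffer_mons (c @ d) (c' @ d')"
    if "c \<in> mons1 X" "marks d = []" "d' \<in> mons1 X" "marks c' = []" "source_mon c = source_mon c'"
      "source_mon d = source_mon d'"
    for c d c' d'
  proof -
    have "embed (source_mon d') = d" "embed (source_mon c) = c'"
      using that embed_source_mon_id[of d] embed_source_mon_id[of c'] by simp_all
    then show ?thesis using peiffer_mons_context[OF hole_one_hole that(1,3), of None] by simp
  qed
  have eq: "c = c'" if "marks c = []" "marks c' = []" "source_mon c = source_mon c'" for c c'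
    using that embed_source_mon_id by metis
  from pos[OF assms(1)] pos[OF assms(2)] show ?thesis
  proof (elim disjE conjE)
    assume "c1 \<in> mons1 X" "marks d1 = []" "c2 \<in> mons1 X" "marks d2 = []"
    then show ?thesis using left eq assms by (auto simp: mons1_def)
  next
    assume "c1 \<in> mons1 X" "marks d1 = []" "d2 \<in> mons1 X" "marks c2 = []"
    then show ?thesis using that(1) peiffer_mons assms by blast
  next
    assume "d1 \<in> mons1 X" "marks c1 = []" "c2 \<in> mons1 X" "marks d2 = []"
    then show ?thesis using that(1) peiffer_mons assms by metis
  next
    assume "d1 \<in> mons1 X" "marks c1 = []" "d2 \<in> mons1 X" "marks c2 = []"
    then show ?thesis using right eq assms by (auto simp: mons1_def)
  qed
qed

lemma common_contextI:
  assumes "c \<in> free_mon (ops X) (vars X <+> gens X)" "d \<in> free_mon (ops X) (vars X <+> gens X)"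
    and "marks c = []" "marks d = []" "c @ d \<noteq> []" "u \<in> mons1 X" "v \<in> mons1 X"
  shows "common_context (c @ u @ d) (c @ v @ d)"
proof -
  define q :: "('z + unit, 'o) mon" where "q = fill (\<lambda>_. []) c @ [Var (Inr ())] @ fill (\<lambda>_. []) d"
  have "fill \<rho> (fill (\<lambda>_. []) c) = c" "fill \<rho> (fill (\<lambda>_. []) d) = d"
    for \<rho> :: "unit \<Rightarrow> ('z + 'g, 'o) mon"
    unfolding fill_fill using assms by (auto intro: fill_id)
  then have "fill (\<lambda>_. u) q = c @ u @ d" "fill (\<lambda>_. v) q = c @ v @ d" by (simp_all add: q_def)
  moreover have "q \<in> one_hole (ops X) (vars X)"
    using assms by (auto simp: q_def one_hole_def marks_fill intro!: fill_in_free_mon)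
  moreover have "q \<noteq> [Var (Inr ())]"
  proof
    assume "q = [Var (Inr ())]"
    then have "fill (\<lambda>_. u) q = u" by simp
    with \<open>fill (\<lambda>_. u) q = c @ u @ d\<close> have "length u = length c + (length u + length d)"
      by (metis length_append)
    then show False using assms(5) by simp
  qed
  ultimately show ?thesis using assms(6,7) unfolding common_context_def by (metis same_cell_refl)
qed

lemma common_context_Br:
  assumes "\<tau> \<in> ops X" "c \<in> free_mon (ops X) (vars X <+> gens X)"
    "d \<in> free_mon (ops X) (vars X <+> gens X)"
    and "marks c = []" "marks d = []" "u \<in> mons1 X" "v \<in> mons1 X"
  shows "common_context (c @ [Br \<tau> u] @ d) (c @ [Br \<tau> v] @ d)"
proof -
  define q :: "('z + unit, 'o) mon" where
    "q = fill (\<lambda>_. []) c @ [Br \<tau> [Var (Inr ())]] @ fill (\<lambda>_. []) d"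
  have "fill \<rho> (fill (\<lambda>_. []) c) = c" "fill \<rho> (fill (\<lambda>_. []) d) = d"
    for \<rho> :: "unit \<Rightarrow> ('z + 'g, 'o) mon"
    unfolding fill_fill using assms by (auto intro: fill_id)
  then have "fill (\<lambda>_. u) q = c @ [Br \<tau> u] @ d" "fill (\<lambda>_. v) q = c @ [Br \<tau> v] @ d"
    by (simp_all add: q_def)
  moreover have "q \<in> one_hole (ops X) (vars X)"
    using assms by (auto simp: q_def one_hole_def marks_fill intro!: fill_in_free_mon)
  moreover have "q \<noteq> [Var (Inr ())]" by (auto simp: q_def append_eq_Cons_conv)
  ultimately show ?thesis using assms(6,7) unfolding common_context_def by (metis same_cell_refl)
qed

text \<open>A common outer letter on the side of words may be a single bracket, which is not a context of
  the free operated monoid. It then extends to a whole bracketed factor: if both cells rewrite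
  inside it or both outside it, there is a common context; if not, they form a Peiffer pair.\<close>

lemma common_end:
  assumes "u \<in> mons1 X" "v \<in> mons1 X" "source_mon u = source_mon v"
    and "unbracket u = Var (Inl x) # s \<and> unbracket v = Var (Inl x) # t \<or>
      unbracket u = s @ [Var (Inl x)] \<and> unbracket v = t @ [Var (Inl x)]"
  shows "peiffer_mons u v \<or> peiffer_mons v u \<or> common_context u v"
  using assms(4)
proof (elim disjE conjE)
  assume "unbracket u = Var (Inl x) # s" "unbracket v = Var (Inl x) # t"
  then show ?thesis
  proof (cases rule: same_first_letter)
    case (Var z u' v')
    from rewriting_positions[of "[Var (Inl z)]" u' "[Var (Inl z)]" v'] show ?thesis
      using assms(1-3) Var common_contextI[of "[Var (Inl z)]" "[]" u' v'] by (auto simp: mons1_def)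
  next
    case (Br \<tau> a b u' v')
    have "[Br \<tau> a] @ u' \<in> mons1 X" "[Br \<tau> b] @ v' \<in> mons1 X"
      "source_mon [Br \<tau> a] = source_mon [Br \<tau> b]" "source_mon u' = source_mon v'"
        using assms(1-3) Br by simp_all
    then show ?thesis
    proof (cases rule: rewriting_positions)
      case left
      then show ?thesis using common_context_Br[of \<tau> "[]" u' a b] Br by (auto simp: mons1_def)
    next
      case right
      then show ?thesis using common_contextI[of "[Br \<tau> a]" "[]" u' v'] Br by auto
    qed (use Br in auto)
  qed
next
  assume "unbracket u = s @ [Var (Inl x)]" "unbracket v = t @ [Var (Inl x)]"
  then show ?thesis
  proof (cases rule: same_last_letter)
    case (Var z u' v')
    from rewriting_positions[of u' "[Var (Inl z)]" v' "[Var (Inl z)]"] show ?thesis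
      using assms(1-3) Var common_contextI[of "[]" "[Var (Inl z)]" u' v'] by (auto simp: mons1_def)
  next
    case (Br \<tau> a b u' v')
    have "u' @ [Br \<tau> a] \<in> mons1 X" "v' @ [Br \<tau> b] \<in> mons1 X"
      "source_mon u' = source_mon v'" "source_mon [Br \<tau> a] = source_mon [Br \<tau> b]"
        using assms(1-3) Br by simp_all
    then show ?thesis
    proof (cases rule: rewriting_positions)
      case right
      then show ?thesis using common_context_Br[of \<tau> u' "[]" a b] Br by (auto simp: mons1_def)
    next
      case left
      then show ?thesis using common_contextI[of "[]" "[Br \<tau> a]" u' v'] Br by auto
    qed (use Br in auto)
  qed
qed

lemma critical_mons_sym: "(u, v) \<in> critical_mons \<Longrightarrow> (v, u) \<in> critical_mons"
  by (auto simp: critical_mons_def same_cell_def common_context_def)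

interpretation S: monomial_polygraph "linear_polygraph_of X"
  by unfold_locales (rule left_monomial_linear_polygraph_of[OF left_monomial])

lemma src_mon_linear: "\<alpha> \<in> gens X \<Longrightarrow> S.src_mon \<alpha> = psi_inv_mon (src_mon \<alpha>)"
  by (rule S.src_eqI) (simp add: src_monomial psi_inv_linear)

lemma unbracket_mons1 [simp]: "unbracket u \<in> mons1 (linear_polygraph_of X) \<longleftrightarrow> u \<in> mons1 X"
  by (simp add: mons1_def)

lemma source_mon_unbracket: "u \<in> mons1 X \<Longrightarrow> S.source_mon (unbracket u) = psi_inv_mon (source_mon u)"
proof (rule embed_injective)
  assume "u \<in> mons1 X"
  then have "fill (\<lambda>\<alpha>. embed (S.src_mon \<alpha>)) (unbracket u) =
    fill (\<lambda>\<alpha>. unbracket (embed (src_mon \<alpha>))) (unbracket u)"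
    using mons1_marks[of u X] by (intro fill_cong) (auto simp: unbracket_embed src_mon_linear)
  then show "embed (S.source_mon (unbracket u)) = embed (psi_inv_mon (source_mon u))"
    by (simp add: S.embed_source_mon unbracket_fill embed_source_mon flip: unbracket_embed)
qed

lemma source_mon_unbracket_eq_iff:
  "u \<in> mons1 X \<Longrightarrow> v \<in> mons1 X \<Longrightarrow> S.source_mon (unbracket u) = S.source_mon (unbracket v) \<longleftrightarrow>
    source_mon u = source_mon v"
  by (simp add: source_mon_unbracket)

lemma same_cell_unbracket:
  assumes "u \<in> mons1 X" "v \<in> mons1 X"
  shows "S.same_cell (unbracket u) (unbracket v) \<longleftrightarrow> same_cell u v"
proof -
  have "S.same_cell (unbracket u) (unbracket v) \<longleftrightarrow>
    unbracket_alg (monomial u - monomial v) \<in> exchange_ideal (linear_polygraph_of X)"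
    unfolding S.same_cell_def
    using assms by (subst cell_eq_iff) (simp_all add: S.mons1_pre_cells1 unbracket_alg_linear)
  then show ?thesis
    using assms by (simp add: unbracket_alg_exchange_ideal_iff same_cell_def cell_eq_iff
      mons1_pre_cells1)
qed

lemma balanced_source_mon:
  assumes "w \<in> mons1 (linear_polygraph_of X)"
  shows "balanced (embed (S.source_mon w)) \<longleftrightarrow> balanced w"
  unfolding S.embed_source_mon
proof (rule balanced_fill)
  fix \<alpha> assume "\<alpha> \<in> set (marks w)"
  then have "\<alpha> \<in> gens X" using mons1_marks[OF assms] by auto
  then show "balanced (embed (S.src_mon \<alpha>))" by (simp add: src_mon_linear flip: unbracket_embed)
qed

text \<open>A cell with a representative in the image of \<^const>\<open>unbracket\<close> has all its one-monomials there,
  because the source decides whether a one-monomial is balanced.\<close>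

lemma same_cell_unbracket_ex:
  assumes "S.same_cell (unbracket u) w" "u \<in> mons1 X" "w \<in> mons1 (linear_polygraph_of X)"
  obtains v where "w = unbracket v" "v \<in> mons1 X" "same_cell u v"
proof -
  have "S.source_mon w = psi_inv_mon (source_mon u)"
    using S.same_cell_source_mon[OF assms(1)] assms by (simp add: source_mon_unbracket)
  then have "balanced w"
    using balanced_source_mon[OF assms(3)] by (simp flip: unbracket_embed)
  then obtain v where v: "w = unbracket v" by (auto simp: balanced_iff_unbracket)
  then have "v \<in> mons1 X" using assms(3) by simp
  with v show ?thesis using that assms same_cell_unbracket by simp
qed

lemma rewrite_linear:
  assumes "\<alpha> \<in> gens X" "\<beta> \<in> gens X"
  shows "S.rewrite_left \<alpha> \<beta> = (\<lambda>b. unbracket (rewrite_left \<alpha> \<beta> b))"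
    "S.rewrite_right \<alpha> \<beta> = (\<lambda>b. unbracket (rewrite_right \<alpha> \<beta> b))"
  using assms by (auto simp: S.rewrite_left_def rewrite_left_def S.rewrite_right_def
    rewrite_right_def src_mon_linear unbracket_embed)

lemma peiffer_mons_unbracket: "S.peiffer_mons (unbracket u) (unbracket v) \<longleftrightarrow> peiffer_mons u v"
proof
  assume "peiffer_mons u v"
  then obtain q \<alpha> \<beta> where q: "q \<in> free_mon (ops X) (vars X <+> UNIV)" "marks q = [False, True]"
     "\<alpha> \<in> gens X" "\<beta> \<in> gens X" "u = fill (rewrite_left \<alpha> \<beta>) q" "v = fill (rewrite_right \<alpha> \<beta>) q"
    by (auto simp: peiffer_mons_def)
  then show "S.peiffer_mons (unbracket u) (unbracket v)"
    unfolding S.peiffer_mons_def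
    by (intro exI[of _ "unbracket q"] exI[of _ \<alpha>] exI[of _ \<beta>]) (simp add: rewrite_linear
      unbracket_fill)
next
  assume "S.peiffer_mons (unbracket u) (unbracket v)"
  then obtain q' \<alpha> \<beta> where q': "q' \<in> free_mon {} (bracket_letters (ops X) (vars X) <+> UNIV)"
     "marks q' = [False, True]" "\<alpha> \<in> gens X" "\<beta> \<in> gens X"
     "unbracket u = fill (S.rewrite_left \<alpha> \<beta>) q'" "unbracket v = fill (S.rewrite_right \<alpha> \<beta>) q'"
    by (auto simp: S.peiffer_mons_def)
  have "balanced q'"
    using balanced_unbracket[of u] balanced_fill[of q' "S.rewrite_left \<alpha> \<beta>"] q'
    by (simp add: rewrite_linear)
  then obtain q where q: "q' = unbracket q" by (auto simp: balanced_iff_unbracket)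
  have "unbracket u = unbracket (fill (rewrite_left \<alpha> \<beta>) q)"
    "unbracket v = unbracket (fill (rewrite_right \<alpha> \<beta>) q)"
    using q' by (simp_all add: q rewrite_linear unbracket_fill)
  then show "peiffer_mons u v"
    unfolding peiffer_mons_def using q' q by (intro exI[of _ q] exI[of _ \<alpha>] exI[of _ \<beta>]) simp
qed

lemma unbracket_one_hole [simp]:
  "unbracket q \<in> one_hole {} (bracket_letters (ops X) (vars X)) \<longleftrightarrow> q \<in> one_hole (ops X) (vars X)"
  by (simp add: one_hole_def)

lemma common_context_unbracket:
  "common_context u v \<Longrightarrow> u \<in> mons1 X \<Longrightarrow> v \<in> mons1 X \<Longrightarrow> S.common_context (unbracket u) (unbracket v)"
proof -
  assume uv: "u \<in> mons1 X" "v \<in> mons1 X" and "common_context u v"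
  then obtain q a b where q: "q \<in> one_hole (ops X) (vars X)" "q \<noteq> [Var (Inr ())]"
     "a \<in> mons1 X" "b \<in> mons1 X" "same_cell u (fill (\<lambda>_. a) q)" "same_cell v (fill (\<lambda>_. b) q)"
    by (auto simp: common_context_def)
  have "unbracket q \<noteq> unbracket [Var (Inr ())]" using q(2) unfolding unbracket_inject .
  moreover have "S.same_cell (unbracket u) (fill (\<lambda>_. unbracket a) (unbracket q))"
    "S.same_cell (unbracket v) (fill (\<lambda>_. unbracket b) (unbracket q))"
    using q uv by (simp_all add: same_cell_unbracket fill_mons1 flip: unbracket_fill)
  ultimately show "S.common_context (unbracket u) (unbracket v)"
    unfolding S.common_context_def using q
    by (intro exI[of _ "unbracket q"] exI[of _ "unbracket a"] exI[of _ "unbracket b"]) simp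
qed

text \<open>A nontrivial context of words has a first or a last letter, which both cells share.\<close>

lemma common_context_rebracket:
  assumes "S.common_context (unbracket u) (unbracket v)" "u \<in> mons1 X" "v \<in> mons1 X"
    "source_mon u = source_mon v"
    and no_peiffer: "\<And>u' v'. same_cell u u' \<Longrightarrow> same_cell v v' \<Longrightarrow> \<not> peiffer_mons u' v' \<and>
      \<not> peiffer_mons v' u'"
  shows "common_context u v"
proof -
  obtain q a b where q: "q \<in> one_hole {} (bracket_letters (ops X) (vars X))" "q \<noteq> [Var (Inr ())]"
     "a \<in> mons1 (linear_polygraph_of X)" "b \<in> mons1 (linear_polygraph_of X)"
     "S.same_cell (unbracket u) (fill (\<lambda>_. a) q)" "S.same_cell (unbracket v) (fill (\<lambda>_. b) q)"
    using assms(1) by (auto simp: S.common_context_def)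
  have "fill (\<lambda>_. a) q \<in> mons1 (linear_polygraph_of X)"
    "fill (\<lambda>_. b) q \<in> mons1 (linear_polygraph_of X)"
    using q by (auto intro: fill_mons1)
  then obtain u' v' where u': "fill (\<lambda>_. a) q = unbracket u'" "u' \<in> mons1 X" "same_cell u u'"
    and v': "fill (\<lambda>_. b) q = unbracket v'" "v' \<in> mons1 X" "same_cell v v'"
    using q(5,6) assms(2,3) same_cell_unbracket_ex by metis
  have s: "source_mon u' = source_mon v'"
    using same_cell_source_mon[OF u'(3)] same_cell_source_mon[OF v'(3)] assms(2-4) u' v' by simp
  obtain w w' where w: "q = embed w @ [Var (Inr ())] @ embed w'"
    using q(1) word_one_mark[of q "bracket_letters (ops X) (vars X)" UNIV "()"]
    by (auto simp: one_hole_def)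
  have q_free: "embed w @ embed w' \<in> free_mon {} (bracket_letters (ops X) (vars X) <+> (UNIV ::
    unit set))"
    using q(1) by (simp add: w one_hole_def)
  have "\<exists>x s t. unbracket u' = Var (Inl x) # s \<and> unbracket v' = Var (Inl x) # t \<or>
      unbracket u' = s @ [Var (Inl x)] \<and> unbracket v' = t @ [Var (Inl x)]"
  proof (cases w)
    case (Cons c w1)
    then obtain x where "c = Var x" using q_free by (cases c) auto
    then have "unbracket u' = Var (Inl x) # (embed w1 @ a @ embed w')"
      "unbracket v' = Var (Inl x) # (embed w1 @ b @ embed w')"
      by (simp_all add: w Cons flip: u'(1) v'(1))
    then show ?thesis by blast
  next
    case Nil
    then have "w' \<noteq> []" using q(2) w by auto
    then obtain w1 c where c: "w' = w1 @ [c]" by (cases w' rule: rev_cases) auto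
    then obtain x where "c = Var x" using q_free by (cases c) auto
    then have "unbracket u' = (embed w @ a @ embed w1) @ [Var (Inl x)]"
      "unbracket v' = (embed w @ b @ embed w1) @ [Var (Inl x)]"
      by (simp_all add: w c flip: u'(1) v'(1))
    then show ?thesis by blast
  qed
  then have "common_context u' v'"
    using common_end[OF u'(2) v'(2) s] no_peiffer[OF u'(3) v'(3)] by blast
  then show ?thesis using u' v' by (auto simp: common_context_def same_cell_def)
qed

lemma critical_mons_unbracket:
  assumes "u \<in> mons1 X" "v \<in> mons1 X"
  shows "(unbracket u, unbracket v) \<in> S.critical_mons \<longleftrightarrow> (u, v) \<in> critical_mons"
proof -
  define P where "P = (\<forall>u' v'. same_cell u u' \<longrightarrow> same_cell v v' \<longrightarrow> \<not> peiffer_mons u' v' \<and>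
    \<not> peiffer_mons v' u')"
  have "(\<forall>u' v'. S.same_cell (unbracket u) u' \<longrightarrow> S.same_cell (unbracket v) v' \<longrightarrow>
    \<not> S.peiffer_mons u' v' \<and> \<not> S.peiffer_mons v' u') \<longleftrightarrow> P"
    (is "?Q \<longleftrightarrow> P")
  proof
    assume ?Q
    show P unfolding P_def
    proof (intro allI impI)
      fix u' v' assume *: "same_cell u u'" "same_cell v v'"
      have "\<not> (peiffer_mons u' v' \<or> peiffer_mons v' u')"
      proof
        assume p: "peiffer_mons u' v' \<or> peiffer_mons v' u'"
        then have "u' \<in> mons1 X" "v' \<in> mons1 X" using peiffer_mons_mons1 by blast+
        then have "S.same_cell (unbracket u) (unbracket u')"
          "S.same_cell (unbracket v) (unbracket v')"
          using * assms by (simp_all add: same_cell_unbracket)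
        then show False using \<open>?Q\<close> p peiffer_mons_unbracket by blast
      qed
      then show "\<not> peiffer_mons u' v' \<and> \<not> peiffer_mons v' u'" by blast
    qed
  next
    assume P
    show ?Q
    proof (intro allI impI)
      fix u' v' assume *: "S.same_cell (unbracket u) u'" "S.same_cell (unbracket v) v'"
      have "\<not> (S.peiffer_mons u' v' \<or> S.peiffer_mons v' u')"
      proof
        assume p: "S.peiffer_mons u' v' \<or> S.peiffer_mons v' u'"
        then have "u' \<in> mons1 (linear_polygraph_of X)" "v' \<in> mons1 (linear_polygraph_of X)"
          using S.peiffer_mons_mons1 by blast+
        then obtain a b where "u' = unbracket a" "same_cell u a" "v' = unbracket b" "same_cell v b"
          using * assms same_cell_unbracket_ex by metis
        then show False using \<open>P\<close> p peiffer_mons_unbracket unfolding P_def by blast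
      qed
      then show "\<not> S.peiffer_mons u' v' \<and> \<not> S.peiffer_mons v' u'" by blast
    qed
  qed
  then show ?thesis
    using assms common_context_unbracket[of u v] common_context_rebracket[of u v]
    unfolding S.critical_mons_def critical_mons_def P_def[symmetric] mem_Collect_eq prod.case
    by (auto simp: source_mon_unbracket_eq_iff same_cell_unbracket P_def)
qed

text \<open>Two one-monomials that rewrite a prefix and a suffix of their source are disjoint, hence a
  Peiffer pair, or overlap. In an overlap the source is balanced because both rewritten words are.\<close>

lemma critical_overlap_balanced:
  assumes "([Var (Inr \<alpha>)] @ embed w, embed x @ [Var (Inr \<beta>)]) \<in> S.critical_mons"
  shows "balanced (embed (S.source_mon ([Var (Inr \<alpha>)] @ embed w)))"
proof -
  let ?u = "[Var (Inr \<alpha>)] @ embed w" and ?v = "embed x @ [Var (Inr \<beta>)]"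
  have m: "?u \<in> mons1 (linear_polygraph_of X)" "?v \<in> mons1 (linear_polygraph_of X)"
    and s: "S.source_mon ?u = S.source_mon ?v" and p: "\<not> S.peiffer_mons ?u ?v"
    using assms by (auto simp: S.critical_mons_def)
  have g: "\<alpha> \<in> gens X" "\<beta> \<in> gens X" using m by (auto simp: mons1_def)
  have bal: "balanced (embed (S.src_mon \<gamma>))" if "\<gamma> \<in> gens X" for \<gamma>
    using that by (simp add: src_mon_linear flip: unbracket_embed)
  have "S.src_mon \<alpha> @ w = x @ S.src_mon \<beta>" using s by simp
  then consider y where "S.src_mon \<alpha> = x @ y" "y @ w = S.src_mon \<beta>"
    | y where "S.src_mon \<alpha> @ y = x" "w = y @ S.src_mon \<beta>"
    by (auto simp: append_eq_append_conv2)
  then show ?thesis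
  proof cases
    case 1
    then have "balanced (embed x @ embed y @ embed w)"
      using bal[OF g(1)] bal[OF g(2)] by (intro balanced_overlap) (simp_all flip: embed_append)
    moreover have "S.source_mon ?u = x @ y @ w" using 1(1) by simp
    ultimately show ?thesis by (simp only: embed_append)
  next
    case 2
    have "S.peiffer_mons ?u ?v"
      unfolding S.peiffer_mons_def
    proof (intro exI conjI)
      let ?q = "[Var (Inr False)] @ embed y @ [Var (Inr True)]"
      show "?q \<in> free_mon (ops (linear_polygraph_of X)) (vars (linear_polygraph_of X) <+> UNIV)"
        using m(2) 2(1) by (auto simp: mons1_def)
      show "marks ?q = [False, True]" by simp
      show "\<alpha> \<in> gens (linear_polygraph_of X)" "\<beta> \<in> gens (linear_polygraph_of X)" using g by simp_all
      show "?u = fill (S.rewrite_left \<alpha> \<beta>) ?q" "?v = fill (S.rewrite_right \<alpha> \<beta>) ?q"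
        using 2 by (auto simp: S.rewrite_left_def S.rewrite_right_def)
    qed
    with p show ?thesis by blast
  qed
qed

text \<open>Without a common outer letter, one of the two cells begins with its generator and one of them
  ends with its generator. If it is the same cell, the source is the source of a generator;
  otherwise the two generators overlap.\<close>

lemma critical_mons_balanced:
  assumes "(u, v) \<in> S.critical_mons"
  shows "balanced u" "balanced v"
proof -
  have m: "u \<in> mons1 (linear_polygraph_of X)" "v \<in> mons1 (linear_polygraph_of X)"
    and s: "S.source_mon u = S.source_mon v" and e: "\<not> S.common_context u v"
    using assms by (auto simp: S.critical_mons_def)
  obtain \<alpha> where \<alpha>: "\<alpha> \<in> gens X" "marks u = [\<alpha>]" using m(1) by (auto elim: mons1_cases)
  obtain \<beta> where \<beta>: "\<beta> \<in> gens X" "marks v = [\<beta>]" using m(2) by (auto elim: mons1_cases)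
  obtain w w' where u: "u = embed w @ [Var (Inr \<alpha>)] @ embed w'"
    using m(1) \<alpha>(2) word_one_mark[of u "bracket_letters (ops X) (vars X)" "gens X" \<alpha>]
    by (auto simp: mons1_def)
  obtain x x' where v: "v = embed x @ [Var (Inr \<beta>)] @ embed x'"
    using m(2) \<beta>(2) word_one_mark[of v "bracket_letters (ops X) (vars X)" "gens X" \<beta>]
    by (auto simp: mons1_def)
  have eq: "w @ S.src_mon \<alpha> @ w' = x @ S.src_mon \<beta> @ x'" using s by (simp add: u v)
  have bal: "balanced (embed (S.src_mon \<gamma>))" if "\<gamma> \<in> gens X" for \<gamma>
    using that by (simp add: src_mon_linear flip: unbracket_embed)
  have left: "w = [] \<or> x = []"
  proof (rule ccontr)
    assume "\<not> (w = [] \<or> x = [])"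
    then obtain c w1 x1 where c: "w = [c] @ w1" "x = [c] @ x1"
      using eq by (cases w; cases x) auto
    then obtain y where y: "c = Var y" using m(1) by (cases c) (auto simp: u mons1_def)
    have "S.common_context (embed [c] @ (embed w1 @ [Var (Inr \<alpha>)] @ embed w') @ [])
        (embed [c] @ (embed x1 @ [Var (Inr \<beta>)] @ embed x') @ [])"
      by (rule S.common_contextI) (use m c y in \<open>auto simp: u v mons1_def\<close>)
    then show False using e by (simp add: u v c y)
  qed
  have right: "w' = [] \<or> x' = []"
  proof (rule ccontr)
    assume "\<not> (w' = [] \<or> x' = [])"
    then obtain c w1 x1 where c: "w' = w1 @ [c]" "x' = x1 @ [c]"
      using eq by (cases w' rule: rev_cases; cases x' rule: rev_cases) auto
    then obtain y where y: "c = Var y" using m(1) by (cases c) (auto simp: u mons1_def)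
    have "S.common_context ([] @ (embed w @ [Var (Inr \<alpha>)] @ embed w1) @ embed [c])
        ([] @ (embed x @ [Var (Inr \<beta>)] @ embed x1) @ embed [c])"
      by (rule S.common_contextI) (use m c y in \<open>auto simp: u v mons1_def\<close>)
    then show False using e by (simp add: u v c y)
  qed
  have "balanced (embed (S.source_mon u))"
  proof -
    consider "w = []" "w' = []" | "x = []" "x' = []" | "w = []" "x' = []" | "x = []" "w' = []"
      using left right by blast
    then show ?thesis
    proof cases
      case 1
      then show ?thesis using bal[OF \<alpha>(1)] by (simp add: u)
    next
      case 2
      then show ?thesis unfolding s using bal[OF \<beta>(1)] by (simp add: v)
    next
      case 3
      then show ?thesis using critical_overlap_balanced[of \<alpha> w' x \<beta>] assms by (simp add: u v)
    next
      case 4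
      then show ?thesis unfolding s
        using critical_overlap_balanced[of \<beta> x' w \<alpha>] S.critical_mons_sym[OF assms]
        by (simp add: u v)
    qed
  qed
  then show "balanced u" "balanced v"
    using balanced_source_mon m s by metis+
qed

lemma critical_mons_linear: "S.critical_mons = map_prod unbracket unbracket ` critical_mons"
proof (intro equalityI subsetI)
  fix p assume p: "p \<in> S.critical_mons"
  then obtain u' v' where p': "p = (u', v')" by (cases p)
  then obtain u v where uv: "u' = unbracket u" "v' = unbracket v"
    using critical_mons_balanced[of u' v'] p by (auto simp: balanced_iff_unbracket)
  then have "u \<in> mons1 X" "v \<in> mons1 X" using p p' by (auto simp: S.critical_mons_def)
  then show "p \<in> map_prod unbracket unbracket ` critical_mons" using p critical_mons_unbracket
    by (auto simp: p' uv)
next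
  fix p assume "p \<in> map_prod unbracket unbracket ` critical_mons"
  then show "p \<in> S.critical_mons" using critical_mons_unbracket by (auto simp: critical_mons_def)
qed

lemma critical_branchings_bij:
  "\<exists>\<phi>. bij_betw \<phi> (critical_branchings X) (critical_branchings (linear_polygraph_of X))"
proof -
  have eq: "critical_branchings (linear_polygraph_of X) = (\<lambda>(u, v).
      (cell (linear_polygraph_of X) (monomial (unbracket u)),
        cell (linear_polygraph_of X) (monomial (unbracket v)))) ` critical_mons"
    unfolding S.critical_branchings_eq critical_mons_linear
    by (simp add: image_image case_prod_beta)
  show ?thesis
    unfolding eq critical_branchings_eq
  proof (rule ex_bij_betw_images)
    fix p p' assume "p \<in> critical_mons" "p' \<in> critical_mons"
    then show "(case p of (u, v) \<Rightarrow> (cell X (monomial u), cell X (monomial v))) =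
        (case p' of (u, v) \<Rightarrow> (cell X (monomial u), cell X (monomial v))) \<longleftrightarrow>
      (case p of (u, v) \<Rightarrow> (cell (linear_polygraph_of X) (monomial (unbracket u)),
        cell (linear_polygraph_of X) (monomial (unbracket v)))) =
        (case p' of (u, v) \<Rightarrow> (cell (linear_polygraph_of X) (monomial (unbracket u)),
          cell (linear_polygraph_of X) (monomial (unbracket v))))"
      using same_cell_unbracket unfolding same_cell_def S.same_cell_def
      by (auto simp: critical_mons_def split: prod.splits)
  qed
qed

end

theorem theorem4p3p1:
  fixes X :: "('z, 'o, 'g, 'k::field_char_0) polygraph"
  assumes "left_monomial_polygraph X"
  shows "\<exists>\<phi>. bij_betw \<phi> (critical_branchings X) (critical_branchings (linear_polygraph_of X))"
  by (rule monomial_polygraph.critical_branchings_bij) (rule monomial_polygraph.intro[OF assms])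

end
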